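(* Let $m,n\ge 0$ be integers, not both zero, and let $r_i,\lambda_{1,i}\in\mathbb{R}^+$ ($1\le i\le m$), $\lambda_{2,j}\in\mathbb{R}^+$, $\mu_j\in(0,1]$ ($1\le j\le n$). Consider the random variable $$T=\sum_{i=1}^{m}Y_i+\sum_{j=1}^{n}Z_j,$$ where $Y_i\sim\Gamma(r_i,\lambda_{1,i})$ and $Z_j\sim \mathrm{ML}(\mu_j,\lambda_{2,j})$ are all independent of each other. Then the density function $f_T^{m,n}(t)$ of $T$ solves the fractional differential equation $$\mathcal{A}_{m,n}\left(\frac{\mathrm d}{\mathrm dt}\right)\left[f_T^{m,n}\right](t):=\bigodot_{j=1}^{n}\left({}_{0}\mathrm{D}_t^{\mu_j}+\lambda_{2,j}\right)\bigodot_{i=1}^{m}{}^{\lambda_{1,i}}_{0}\mathrm{R}_t^{r_i}\left[f_T^{m,n}\right](t)=0,\qquad t>0,$$ with boundary conditions (when $n\neq 0$) $${}_{0}\mathrm{D}_t^{\mu_1-1}\bigodot_{j=2}^{n}\left({}_{0}\mathrm{D}_t^{\mu_j}+\lambda_{2,j}\right)\bigodot_{i=1}^{m}{}^{\lambda_{1,i}}_{0}\mathrm{R}_t^{r_i}\left[f_T^{m,n}\right](t)\Big|_{t=0}=\Lambda_{m,n}$$ and $${}_{0}\mathrm{D}_t^{\mu_1-k}\bigodot_{j=2}^{n}\left({}_{0}\mathrm{D}_t^{\mu_j}+\lambda_{2,j}\right)\bigodot_{i=1}^{m}{}^{\lambda_{1,i}}_{0}\mathrm{R}_t^{r_i}\left[f_T^{m,n}\right](t)\Big|_{t=0}=0$$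 for $k=2,\dots,\left\lceil\sum_{j=1}^n\mu_j+\sum_{i=1}^m r_i\right\rceil$, where $$\Lambda_{m,n}:=\prod_{i=1}^m\lambda_{1,i}^{r_i}\prod_{j=1}^n\lambda_{2,j}.$$
   Context: $\Gamma(r,\lambda)$ denotes the gamma distribution with density $\frac{\lambda^r}{\Gamma(r)}x^{r-1}e^{-\lambda x}$, $x>0$. $\mathrm{ML}(\mu,\lambda)$, with $\mu\in(0,1]$ and $\lambda>0$, denotes the Mittag-Leffler distribution with density $\lambda x^{\mu-1}E_{\mu,\mu}(-\lambda x^\mu)$, $x>0$, where $E_{\alpha,\beta}(z)=\sum_{k=0}^\infty \frac{z^k}{\Gamma(\alpha k+\beta)}$. The left Riemann-Liouville fractional integral of order $r>0$ is ${}_{0}\mathrm{I}_x^r f(x)=\frac{1}{\Gamma(r)}\int_0^x (x-y)^{r-1}f(y)\,\mathrm dy$. The left Riemann-Liouville fractional derivative of order $r>0$ is ${}_{0}\mathrm{D}_x^r f(x)=\frac{1}{\Gamma(N-r)}\frac{\mathrm d^N}{\mathrm dx^N}\int_0^x (x-y)^{N-r-1}f(y)\,\mathrm dy$ with $N=\lfloor r\rfloor+1$. Conventions: ${}_{0}\mathrm{D}_x^{0}$ is the identity and ${}_{0}\mathrm{D}_x^{-s}={}_{0}\mathrm{I}_x^{s}$ for $s>0$. The left fractional differential operator is ${}^{\alpha}_{0}\mathrm{R}_x^r[f](x)=e^{-\alpha x}\,{}_{0}\mathrm{D}_x^r\left[e^{\alpha x}f(x)\right]$. $\bigodot$ denotes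 left-composition of operators: $\bigodot_{j=1}^m\mathcal L_j[f]=(\mathcal L_m\circ\cdots\circ\mathcal L_1)[f]$ (an empty composition is the identity); in a juxtaposition of operators, the rightmost acts first. Empty sums are $0$ and empty products are $1$. Evaluation at $t=0$ is understood as the limit $t\to0^+$. *)

theory Defs
  imports "HOL-Probability.Probability"
begin

section \<open>Gamma and Mittag-Leffler densities\<close>

definition gamma_density :: "real \<Rightarrow> real \<Rightarrow> real \<Rightarrow> real" where
  "gamma_density r l x =
     (if x > 0 then l powr r / Gamma r * x powr (r - 1) * exp (- l * x) else 0)"

definition mittag_leffler :: "real \<Rightarrow> real \<Rightarrow> real \<Rightarrow> real" where
  "mittag_leffler \<alpha> \<beta> z = (\<Sum>k. z ^ k / Gamma (\<alpha> * real k + \<beta>))"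

definition mittag_leffler_density :: "real \<Rightarrow> real \<Rightarrow> real \<Rightarrow> real" where
  "mittag_leffler_density \<mu> l x =
     (if x > 0 then l * x powr (\<mu> - 1) * mittag_leffler \<mu> \<mu> (- l * x powr \<mu>) else 0)"

text \<open>
  \<open>ennreal\<close> truncates negative values to \<open>0\<close>, so nonnegativity of the density is stated separately.
\<close>

definition has_density :: "'a measure \<Rightarrow> ('a \<Rightarrow> real) \<Rightarrow> (real \<Rightarrow> real) \<Rightarrow> bool" where
  "has_density M X g \<longleftrightarrow> (\<forall>x. 0 \<le> g x) \<and> distributed M lborel X (\<lambda>x. ennreal (g x))"

text \<open>
  A density is only determined almost everywhere, whereas the differential equation is
  pointwise on \<open>t > 0\<close>.  ``The'' density is the version that is continuous on the open
  half-line; its values there are uniquely determined.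
\<close>

definition is_continuous_density :: "'a measure \<Rightarrow> ('a \<Rightarrow> real) \<Rightarrow> (real \<Rightarrow> real) \<Rightarrow> bool" where
  "is_continuous_density M T f \<longleftrightarrow> has_density M T f \<and> continuous_on {0<..} f"

section \<open>Riemann-Liouville operators\<close>

text \<open>
  All operators are total on \<^typ>\<open>real \<Rightarrow> real\<close>, and only the values at arguments \<open>x > 0\<close> are
  meaningful.  The library's integral and \<^const>\<open>deriv\<close> return arbitrary values where they do
  not exist; the predicates \<open>RL_defined\<close>, \<open>R_defined\<close> and \<open>compose_defined\<close> below state
  that everything does exist.
\<close>

definition RL_kernel_integral :: "real \<Rightarrow> (real \<Rightarrow> real) \<Rightarrow> real \<Rightarrow> real" where
  "RL_kernel_integral s f x = (LBINT y:{0..x}. (x - y) powr (s - 1) * f y)"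

definition RL_integral :: "real \<Rightarrow> (real \<Rightarrow> real) \<Rightarrow> real \<Rightarrow> real" where
  "RL_integral s f x = 1 / Gamma s * RL_kernel_integral s f x"

definition RL_order :: "real \<Rightarrow> nat" where
  "RL_order r = nat \<lfloor>r\<rfloor> + 1"

definition RL_deriv :: "real \<Rightarrow> (real \<Rightarrow> real) \<Rightarrow> real \<Rightarrow> real" where
  "RL_deriv r f x =
     (if r > 0 then
        1 / Gamma (real (RL_order r) - r) *
          (deriv ^^ RL_order r) (RL_kernel_integral (real (RL_order r) - r) f) x
      else if r = 0 then f x
      else RL_integral (- r) f x)"

definition RL_integrable :: "real \<Rightarrow> (real \<Rightarrow> real) \<Rightarrow> bool" where
  "RL_integrable s f \<longleftrightarrow>
     (\<forall>x>0. set_integrable lborel {0..x} (\<lambda>y. (x - y) powr (s - 1) * f y))"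

definition RL_defined :: "real \<Rightarrow> (real \<Rightarrow> real) \<Rightarrow> bool" where
  "RL_defined r f \<longleftrightarrow>
     (if r > 0 then
        RL_integrable (real (RL_order r) - r) f \<and>
        (\<forall>k<RL_order r. \<forall>x>0.
           (deriv ^^ k) (RL_kernel_integral (real (RL_order r) - r) f) differentiable (at x))
      else if r = 0 then True
      else RL_integrable (- r) f)"

definition R_op :: "real \<Rightarrow> real \<Rightarrow> (real \<Rightarrow> real) \<Rightarrow> real \<Rightarrow> real" where
  "R_op \<alpha> r f x = exp (- \<alpha> * x) * RL_deriv r (\<lambda>y. exp (\<alpha> * y) * f y) x"

definition R_defined :: "real \<Rightarrow> real \<Rightarrow> (real \<Rightarrow> real) \<Rightarrow> bool" where
  "R_defined \<alpha> r f \<longleftrightarrow> RL_defined r (\<lambda>y. exp (\<alpha> * y) * f y)"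

definition RL_deriv_plus :: "real \<Rightarrow> real \<Rightarrow> (real \<Rightarrow> real) \<Rightarrow> real \<Rightarrow> real" where
  "RL_deriv_plus \<mu> l f x = RL_deriv \<mu> f x + l * f x"

section \<open>Left-composition\<close>

text \<open>\<open>compose_ops a b L\<close> is \<open>L b \<circ> \<dots> \<circ> L a\<close> (so \<open>L a\<close> acts first), the identity if \<open>b < a\<close>.\<close>

definition compose_ops ::
    "nat \<Rightarrow> nat \<Rightarrow> (nat \<Rightarrow> (real \<Rightarrow> real) \<Rightarrow> real \<Rightarrow> real) \<Rightarrow> (real \<Rightarrow> real) \<Rightarrow> real \<Rightarrow> real" where
  "compose_ops a b L f = fold L [a..<Suc b] f"

text \<open>Each factor \<open>L j\<close> is defined (in the sense of \<open>D j\<close>) at the function it is applied to.\<close>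

definition compose_defined ::
    "nat \<Rightarrow> nat \<Rightarrow> (nat \<Rightarrow> (real \<Rightarrow> real) \<Rightarrow> bool) \<Rightarrow>
     (nat \<Rightarrow> (real \<Rightarrow> real) \<Rightarrow> real \<Rightarrow> real) \<Rightarrow> (real \<Rightarrow> real) \<Rightarrow> bool" where
  "compose_defined a b D L f \<longleftrightarrow> (\<forall>j\<in>{a..b}. D j (fold L [a..<j] f))"

definition gamma_ops ::
    "nat \<Rightarrow> (nat \<Rightarrow> real) \<Rightarrow> (nat \<Rightarrow> real) \<Rightarrow> (real \<Rightarrow> real) \<Rightarrow> real \<Rightarrow> real" where
  "gamma_ops m r l = compose_ops 1 m (\<lambda>i. R_op (l i) (r i))"

definition gamma_ops_defined ::
    "nat \<Rightarrow> (nat \<Rightarrow> real) \<Rightarrow> (nat \<Rightarrow> real) \<Rightarrow> (real \<Rightarrow> real) \<Rightarrow> bool" where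
  "gamma_ops_defined m r l =
     compose_defined 1 m (\<lambda>i. R_defined (l i) (r i)) (\<lambda>i. R_op (l i) (r i))"

definition RL_ops ::
    "nat \<Rightarrow> nat \<Rightarrow> (nat \<Rightarrow> real) \<Rightarrow> (nat \<Rightarrow> real) \<Rightarrow> (real \<Rightarrow> real) \<Rightarrow> real \<Rightarrow> real" where
  "RL_ops a b \<mu> l = compose_ops a b (\<lambda>j. RL_deriv_plus (\<mu> j) (l j))"

definition RL_ops_defined ::
    "nat \<Rightarrow> nat \<Rightarrow> (nat \<Rightarrow> real) \<Rightarrow> (nat \<Rightarrow> real) \<Rightarrow> (real \<Rightarrow> real) \<Rightarrow> bool" where
  "RL_ops_defined a b \<mu> l =
     compose_defined a b (\<lambda>j. RL_defined (\<mu> j)) (\<lambda>j. RL_deriv_plus (\<mu> j) (l j))"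

end

theory Submission
  imports Defs
begin

text \<open>
  The density of \<open>T\<close> is the convolution of all the summand densities.  Every Riemann-Liouville
  operator inverts convolution with the kernel \<open>x powr (r - 1) / Gamma r\<close>: by the Beta integral,
  applying \<open>I^(N - r)\<close> to \<open>I^r u\<close> gives \<open>I^N u\<close>, whose \<open>N\<close>-th derivative is \<open>u\<close> wherever \<open>u\<close> is
  continuous, while the kernel itself becomes a polynomial of degree \<open>N - 1\<close> and is annihilated.
  A gamma density is this kernel up to an exponential weight, which the conjugation in \<open>R_op\<close>
  removes.  A Mittag-Leffler density \<open>g\<close> satisfies the Volterra equation
  \<open>g = \<lambda> x powr (\<mu> - 1) / Gamma \<mu> - \<lambda> I^\<mu> g\<close>, so \<open>D^\<mu> + \<lambda>\<close> turns \<open>g * h\<close> into \<open>\<lambda> h\<close> and kills \<open>g\<close>.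
  Thus each factor strips one density off the convolution, and the last one yields zero.  Leaving
  out the factor of index 1 leaves a multiple of the corresponding Mittag-Leffler density, and the
  boundary values follow from the Volterra equation.
\<close>

section \<open>Convolution on the half-line\<close>

text \<open>Values at x \<le> 0 are unconstrained for the functions at hand. Cutting them off lets
  the truncated integral over (0, x) be written over the whole line, where translation, scaling and
  Fubini need no bookkeeping of limits.\<close>

definition zero_ext :: "(real \<Rightarrow> real) \<Rightarrow> real \<Rightarrow> real" where
  "zero_ext g x = indicator {0<..} x * g x"

definition conv :: "(real \<Rightarrow> real) \<Rightarrow> (real \<Rightarrow> real) \<Rightarrow> real \<Rightarrow> real" where
  "conv g h x = (LINT y|lborel. zero_ext g (x - y) * zero_ext h y)"

text \<open>The working class of functions. For a > 0 the bound gives integrability at 0, and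
  convolution stays in the class with the exponents adding up; a kernel of order a, with its
  singularity at 0, is the model member.\<close>

definition power_bounded :: "real \<Rightarrow> (real \<Rightarrow> real) \<Rightarrow> bool" where
  "power_bounded a g \<longleftrightarrow> continuous_on {0<..} g \<and>
     (\<forall>B>0. \<exists>C. \<forall>x\<in>{0<..B}. \<bar>g x\<bar> \<le> C * x powr (a - 1))"

text \<open>Convolution with \<open>power_kernel s\<close> is the Riemann-Liouville integral of
  order s > 0.\<close>

definition power_kernel :: "real \<Rightarrow> real \<Rightarrow> real" where
  "power_kernel s x = x powr (s - 1) / Gamma s"

lemma zero_ext_pos [simp]: "x > 0 \<Longrightarrow> zero_ext g x = g x"
  and zero_ext_nonpos [simp]: "x \<le> 0 \<Longrightarrow> zero_ext g x = 0"
  by (auto simp: zero_ext_def)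

lemma zero_ext_cong: "(\<And>x. x > 0 \<Longrightarrow> g x = h x) \<Longrightarrow> zero_ext g = zero_ext h"
  by (auto simp: zero_ext_def fun_eq_iff split: split_indicator)

lemma conv_cong:
  assumes "\<And>x. x > 0 \<Longrightarrow> g x = g' x" "\<And>x. x > 0 \<Longrightarrow> h x = h' x"
  shows "conv g h = conv g' h'"
  unfolding conv_def using zero_ext_cong[of g g'] zero_ext_cong[of h h'] assms by auto

lemma conv_nonpos [simp]: "x \<le> 0 \<Longrightarrow> conv g h x = 0"
proof -
  assume "x \<le> 0"
  then have "(\<lambda>y. zero_ext g (x - y) * zero_ext h y) = (\<lambda>y. 0)"
    by (auto simp: zero_ext_def fun_eq_iff split: split_indicator)
  then show ?thesis by (simp add: conv_def)
qed

lemma zero_ext_conv [simp]: "zero_ext (conv g h) = conv g h"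
  by (auto simp: zero_ext_def fun_eq_iff split: split_indicator)

section \<open>Closure properties of the power-bounded functions\<close>

lemma power_bounded_continuous: "power_bounded a g \<Longrightarrow> continuous_on {0<..} g"
  by (simp add: power_bounded_def)

lemma power_boundedE:
  assumes "power_bounded a g" "B > 0"
  obtains C where "C \<ge> 0" "\<And>x. x > 0 \<Longrightarrow> x \<le> B \<Longrightarrow> \<bar>g x\<bar> \<le> C * x powr (a - 1)"
proof -
  obtain C where C: "\<forall>x\<in>{0<..B}. \<bar>g x\<bar> \<le> C * x powr (a - 1)"
    using assms unfolding power_bounded_def by blast
  show ?thesis
  proof (rule that[of "max C 0"])
    fix x :: real assume "x > 0" "x \<le> B"
    then have "\<bar>g x\<bar> \<le> C * x powr (a - 1)" using C by auto
    also have "\<dots> \<le> max C 0 * x powr (a - 1)" by (intro mult_right_mono) auto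
    finally show "\<bar>g x\<bar> \<le> max C 0 * x powr (a - 1)" .
  qed auto
qed

lemma power_bounded_cong:
  assumes "power_bounded a g" "\<And>x. x > 0 \<Longrightarrow> f x = g x"
  shows "power_bounded a f"
proof -
  have "continuous_on {0<..} f \<longleftrightarrow> continuous_on {0<..} g"
    using assms(2) by (intro continuous_on_cong) auto
  then show ?thesis using assms unfolding power_bounded_def by auto
qed

lemma power_bounded_cmult: "power_bounded a g \<Longrightarrow> power_bounded a (\<lambda>x. c * g x)"
  unfolding power_bounded_def
proof (safe)
  fix B :: real assume "continuous_on {0<..} g" "B > 0"
    and "\<forall>B>0. \<exists>C. \<forall>x\<in>{0<..B}. \<bar>g x\<bar> \<le> C * x powr (a - 1)"
  then obtain C where C: "\<forall>x\<in>{0<..B}. \<bar>g x\<bar> \<le> C * x powr (a - 1)" by blast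
  show "\<exists>C. \<forall>x\<in>{0<..B}. \<bar>c * g x\<bar> \<le> C * x powr (a - 1)"
    by (rule exI[of _ "\<bar>c\<bar> * C"]) (use C in \<open>auto simp: abs_mult mult.assoc intro!: mult_left_mono\<close>)
qed (auto intro!: continuous_intros)

lemma power_bounded_abs: "power_bounded a g \<Longrightarrow> power_bounded a (\<lambda>x. \<bar>g x\<bar>)"
  unfolding power_bounded_def by (auto intro!: continuous_intros)

lemma power_bounded_weaken:
  assumes "power_bounded a g" "b \<le> a"
  shows "power_bounded b g"
  unfolding power_bounded_def
proof (intro conjI allI impI)
  show "continuous_on {0<..} g" using assms by (simp add: power_bounded_def)
  fix B :: real assume B: "B > 0"
  from power_boundedE[OF assms(1) B] obtain C where
    C: "C \<ge> 0" "\<And>x. x > 0 \<Longrightarrow> x \<le> B \<Longrightarrow> \<bar>g x\<bar> \<le> C * x powr (a - 1)" by blast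
  show "\<exists>C. \<forall>x\<in>{0<..B}. \<bar>g x\<bar> \<le> C * x powr (b - 1)"
  proof (intro exI ballI)
    fix x assume x: "x \<in> {0<..B}"
    have "\<bar>g x\<bar> \<le> C * x powr (a - 1)" using C x by auto
    also have "x powr (a - 1) = x powr (a - b) * x powr (b - 1)"
      using x by (simp add: powr_add [symmetric])
    also have "C * \<dots> \<le> C * (B powr (a - b) * x powr (b - 1))"
      using x C assms(2) by (intro mult_left_mono mult_right_mono powr_mono2) auto
    finally show "\<bar>g x\<bar> \<le> (C * B powr (a - b)) * x powr (b - 1)" by (simp add: mult.assoc)
  qed
qed

lemma power_bounded_add:
  assumes "power_bounded a g" "power_bounded a h"
  shows "power_bounded a (\<lambda>x. g x + h x)"
  unfolding power_bounded_def
proof (intro conjI allI impI)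
  show "continuous_on {0<..} (\<lambda>x. g x + h x)"
    using assms by (auto simp: power_bounded_def intro!: continuous_intros)
  fix B :: real assume B: "B > 0"
  from power_boundedE[OF assms(1) B] obtain C where
    C: "\<And>x. x > 0 \<Longrightarrow> x \<le> B \<Longrightarrow> \<bar>g x\<bar> \<le> C * x powr (a - 1)" by blast
  from power_boundedE[OF assms(2) B] obtain D where
    D: "\<And>x. x > 0 \<Longrightarrow> x \<le> B \<Longrightarrow> \<bar>h x\<bar> \<le> D * x powr (a - 1)" by blast
  show "\<exists>C. \<forall>x\<in>{0<..B}. \<bar>g x + h x\<bar> \<le> C * x powr (a - 1)"
    by (rule exI[of _ "C + D"], safe)
      (use C D in \<open>fastforce simp: distrib_right intro: order_trans[OF abs_triangle_ineq] add_mono\<close>)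
qed

lemma greaterThan_subset_atLeast: "{a<..} \<subseteq> {a::real..}"
  by auto

lemma Gamma_real_nonzero [simp]: "x > 0 \<Longrightarrow> Gamma (x::real) \<noteq> 0"
  by (metis Gamma_real_pos less_irrefl)

text \<open>Continuity of the weight up to 0 makes it bounded on the compact interval [0, B]. This
  admits exponential weights and the entire factor of a Mittag-Leffler density.\<close>

lemma power_bounded_times_continuous:
  assumes "power_bounded a g" "continuous_on {0..} w"
  shows "power_bounded a (\<lambda>x. w x * g x)"
  unfolding power_bounded_def
proof (intro conjI allI impI)
  show "continuous_on {0<..} (\<lambda>x. w x * g x)"
    using assms continuous_on_subset[OF assms(2) greaterThan_subset_atLeast]
    by (auto simp: power_bounded_def intro!: continuous_intros)
  fix B :: real assume B: "B > 0"
  from power_boundedE[OF assms(1) B] obtain C where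
    C: "C \<ge> 0" "\<And>x. x > 0 \<Longrightarrow> x \<le> B \<Longrightarrow> \<bar>g x\<bar> \<le> C * x powr (a - 1)" by blast
  have "bounded (w ` {0..B})"
    by (intro compact_imp_bounded compact_continuous_image continuous_on_subset[OF assms(2)]) auto
  then obtain D where D: "\<And>x. x \<in> {0..B} \<Longrightarrow> \<bar>w x\<bar> \<le> D"
    unfolding bounded_iff by (metis imageI real_norm_def)
  show "\<exists>C. \<forall>x\<in>{0<..B}. \<bar>w x * g x\<bar> \<le> C * x powr (a - 1)"
  proof (intro exI ballI)
    fix x assume x: "x \<in> {0<..B}"
    have "D \<ge> 0" using D[rule_format, of B] B by auto
    then have "\<bar>w x * g x\<bar> \<le> D * (C * x powr (a - 1))"
      using x C D by (auto simp: abs_mult intro!: mult_mono)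
    then show "\<bar>w x * g x\<bar> \<le> (D * C) * x powr (a - 1)" by (simp add: mult.assoc)
  qed
qed

lemma power_bounded_powr: "power_bounded a (\<lambda>x. x powr (a - 1))"
  unfolding power_bounded_def
  by (auto intro!: continuous_intros exI[of _ 1])

lemma power_bounded_power_kernel: "power_bounded a (power_kernel a)"
  using power_bounded_cmult[OF power_bounded_powr, of a "1 / Gamma a"]
  by (simp add: power_kernel_def[abs_def])

section \<open>Integrability, continuity and order of a convolution\<close>

lemma zero_ext_measurable [measurable]:
  assumes "power_bounded a g"
  shows "zero_ext g \<in> borel_measurable borel"
proof -
  have "(\<lambda>x. indicator {0<..} x *\<^sub>R g x) \<in> borel_measurable borel"
    using assms by (intro borel_measurable_continuous_on_indicator) (auto simp: power_bounded_def)
  then show ?thesis by (simp add: zero_ext_def[abs_def])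
qed

text \<open>The substitution y = x t moves the dependence on x from the domain into the integrand,
  so that one integrable majorant on [0, 1] serves a whole range of x.\<close>

lemma conv_scaled:
  assumes "x > 0"
  shows "conv g h x = x * (LINT t|lborel. zero_ext g (x * (1 - t)) * zero_ext h (x * t))"
  unfolding conv_def
  by (subst lborel_integral_real_affine[where c = x and t = 0])
    (use assms in \<open>auto simp: algebra_simps\<close>)

text \<open>For 0 < t < 1 the two power bounds separate into a power of x and the Beta weight in t;
  for every other t one of the zero extensions vanishes. The factor x of the substitution later
  raises the exponent a + b - 2 to a + b - 1.\<close>

lemma scaled_bound:
  assumes g: "power_bounded a g" and h: "power_bounded b h" and B: "B > 0"
  obtains C where "C \<ge> 0" "\<And>x t. 0 < x \<Longrightarrow> x \<le> B \<Longrightarrow>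
     \<bar>zero_ext g (x * (1 - t)) * zero_ext h (x * t)\<bar>
       \<le> C * x powr (a + b - 2) * (indicator {0..1} t * (t powr (b - 1) * (1 - t) powr (a - 1)))"
proof -
  from power_boundedE[OF g B] obtain C where
    C: "C \<ge> 0" "\<And>x. x > 0 \<Longrightarrow> x \<le> B \<Longrightarrow> \<bar>g x\<bar> \<le> C * x powr (a - 1)" by blast
  from power_boundedE[OF h B] obtain D where
    D: "D \<ge> 0" "\<And>x. x > 0 \<Longrightarrow> x \<le> B \<Longrightarrow> \<bar>h x\<bar> \<le> D * x powr (b - 1)" by blast
  show ?thesis
  proof (rule that[of "C * D"])
    fix x t :: real assume x: "0 < x" "x \<le> B"
    show "\<bar>zero_ext g (x * (1 - t)) * zero_ext h (x * t)\<bar>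
       \<le> C * D * x powr (a + b - 2) * (indicator {0..1} t * (t powr (b - 1) * (1 - t) powr (a - 1)))"
    proof (cases "0 < t \<and> t < 1")
      case True
      have le: "x * s \<le> B" if "0 < s" "s < 1" for s
        using mult_mono[of x B s 1] x that by simp
      have "\<bar>zero_ext g (x * (1 - t)) * zero_ext h (x * t)\<bar> = \<bar>g (x * (1 - t))\<bar> * \<bar>h (x * t)\<bar>"
        using True x by (simp add: abs_mult)
      also have "\<dots> \<le> (C * (x * (1 - t)) powr (a - 1)) * (D * (x * t) powr (b - 1))"
        using True x C D le[of t] le[of "1 - t"] by (intro mult_mono) auto
      also have "\<dots> = C * D * (x powr (a - 1) * x powr (b - 1)) * (t powr (b - 1) * (1 - t) powr (a - 1))"
        using True x by (simp add: powr_mult)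
      also have "x powr (a - 1) * x powr (b - 1) = x powr (a + b - 2)"
        by (simp add: powr_add[symmetric])
      finally show ?thesis using True by simp
    next
      case False
      then have "x * (1 - t) \<le> 0 \<or> x * t \<le> 0"
        using x by (auto simp: mult_le_0_iff not_less)
      then have "\<bar>zero_ext g (x * (1 - t)) * zero_ext h (x * t)\<bar> = 0" by auto
      then show ?thesis using C(1) D(1) by (simp del: abs_eq_0 abs_mult)
    qed
  qed (use C D in auto)
qed

lemma Beta_integrable:
  assumes "a > 0" "b > (0::real)"
  shows "integrable lborel (\<lambda>t. indicator {0..1} t * (t powr (b - 1) * (1 - t) powr (a - 1)))"
  using integrable_Beta[of b a] assms by (simp add: set_integrable_def)

lemma Beta_lebesgue_integral:
  assumes "a > 0" "b > (0::real)"
  shows "(LINT t|lborel. indicator {0..1} t * (t powr (b - 1) * (1 - t) powr (a - 1))) = Beta b a"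
  using set_borel_integral_eq_integral(2)[OF integrable_Beta[of b a]] assms
    has_integral_Beta_real[of b a, THEN integral_unique]
  by (simp add: set_lebesgue_integral_def)

lemma scaled_integrable:
  assumes g: "power_bounded a g" and h: "power_bounded b h" and a: "a > 0" "b > 0"
    and x: "x > 0"
  shows "integrable lborel (\<lambda>t. zero_ext g (x * (1 - t)) * zero_ext h (x * t))"
proof -
  note [measurable] = zero_ext_measurable[OF g] zero_ext_measurable[OF h]
  from scaled_bound[OF g h x] obtain C where C: "C \<ge> 0" "\<And>t.
     \<bar>zero_ext g (x * (1 - t)) * zero_ext h (x * t)\<bar>
       \<le> C * x powr (a + b - 2) * (indicator {0..1} t * (t powr (b - 1) * (1 - t) powr (a - 1)))"
    using x by (metis order_refl)
  show ?thesis
  proof (rule Bochner_Integration.integrable_bound[OF integrable_mult_right[OF Beta_integrable[OF a], of "C * x powr (a + b - 2)"]])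
    show "AE t in lborel. norm (zero_ext g (x * (1 - t)) * zero_ext h (x * t))
         \<le> norm (C * x powr (a + b - 2) * (indicator {0..1} t * (t powr (b - 1) * (1 - t) powr (a - 1))))"
      by (intro AE_I2) (use C(2) in \<open>auto simp only: real_norm_def intro: order_trans[OF _ abs_ge_self]\<close>)
  qed measurable
qed

lemma conv_integrable:
  assumes g: "power_bounded a g" and h: "power_bounded b h" and a: "a > 0" "b > 0"
  shows "integrable lborel (\<lambda>y. zero_ext g (x - y) * zero_ext h y)"
proof (cases "x > 0")
  case True
  have "integrable lborel (\<lambda>t. zero_ext g (x - (0 + x * t)) * zero_ext h (0 + x * t))"
    using scaled_integrable[OF assms True] by (simp add: algebra_simps)
  then show ?thesis
    using lborel_integrable_real_affine_iff[of x "\<lambda>y. zero_ext g (x - y) * zero_ext h y" 0] True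
    by blast
next
  case False
  then have "(\<lambda>y. zero_ext g (x - y) * zero_ext h y) = (\<lambda>y. 0)"
    by (auto simp: zero_ext_def fun_eq_iff split: split_indicator)
  then show ?thesis by simp
qed

text \<open>Dominated convergence in the scaled integral, on compact intervals away from 0, with a
  multiple of the Beta weight as majorant.\<close>

lemma conv_continuous:
  assumes g: "power_bounded a g" and h: "power_bounded b h" and a: "a > 0" "b > 0"
  shows "continuous_on {0<..} (conv g h)"
proof -
  note [measurable] = zero_ext_measurable[OF g] zero_ext_measurable[OF h]
  have Icc: "continuous_on {p..q} (conv g h)" if pq: "0 < p" "p < q" for p q
    unfolding continuous_on_sequentially
  proof (safe)
    fix X :: "nat \<Rightarrow> real" and x
    assume x: "x \<in> {p..q}" and X: "\<forall>n. X n \<in> {p..q}" and lim: "X \<longlonglongrightarrow> x"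
    have q: "q > 0" using pq by simp
    from scaled_bound[OF g h q] obtain C where C: "C \<ge> 0" "\<And>x t. 0 < x \<Longrightarrow> x \<le> q \<Longrightarrow>
     \<bar>zero_ext g (x * (1 - t)) * zero_ext h (x * t)\<bar>
       \<le> C * x powr (a + b - 2) * (indicator {0..1} t * (t powr (b - 1) * (1 - t) powr (a - 1)))"
      by blast
    \<comment> \<open>The sign of a + b - 2 is not known, so the maximum of the power may lie at
      either endpoint; the sum of both endpoint values dominates in each case.\<close>
    define K where "K = p powr (a + b - 2) + q powr (a + b - 2)"
    have K: "y powr (a + b - 2) \<le> K" if "y \<in> {p..q}" for y
    proof (cases "a + b - 2 \<ge> 0")
      case True
      then have "y powr (a + b - 2) \<le> q powr (a + b - 2)"
        using that pq by (intro powr_mono2) auto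
      then show ?thesis by (simp add: K_def add_increasing)
    next
      case False
      then have "y powr (a + b - 2) \<le> p powr (a + b - 2)"
        using that pq by (intro powr_mono2') auto
      then show ?thesis by (simp add: K_def add_increasing2)
    qed
    have pos: "X n > 0" for n using X pq by (metis atLeastAtMost_iff less_le_trans)
    have xpos: "x > 0" using x pq by auto
    have gx: "isCont g y" "isCont h y" if "y > 0" for y
      using that g h unfolding power_bounded_def
      by (auto simp: continuous_on_eq_continuous_at)
    have "(\<lambda>n. LINT t|lborel. zero_ext g (X n * (1 - t)) * zero_ext h (X n * t))
       \<longlonglongrightarrow> (LINT t|lborel. zero_ext g (x * (1 - t)) * zero_ext h (x * t))"
    proof (rule integral_dominated_convergence)
      show "integrable lborel (\<lambda>t. C * K * (indicator {0..1} t * (t powr (b - 1) * (1 - t) powr (a - 1))))"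
        by (intro integrable_mult_right Beta_integrable a)
      show "AE t in lborel. norm (zero_ext g (X n * (1 - t)) * zero_ext h (X n * t))
             \<le> C * K * (indicator {0..1} t * (t powr (b - 1) * (1 - t) powr (a - 1)))" for n
      proof (intro AE_I2)
        fix t :: real
        have "norm (zero_ext g (X n * (1 - t)) * zero_ext h (X n * t))
            \<le> C * X n powr (a + b - 2) * (indicator {0..1} t * (t powr (b - 1) * (1 - t) powr (a - 1)))"
          using C(2)[of "X n" t] pos X by auto
        also have "\<dots> \<le> C * K * (indicator {0..1} t * (t powr (b - 1) * (1 - t) powr (a - 1)))"
          using K[of "X n"] X C(1) by (intro mult_right_mono mult_left_mono) auto
        finally show "norm (zero_ext g (X n * (1 - t)) * zero_ext h (X n * t))
             \<le> C * K * (indicator {0..1} t * (t powr (b - 1) * (1 - t) powr (a - 1)))" .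
      qed
      show "AE t in lborel. (\<lambda>n. zero_ext g (X n * (1 - t)) * zero_ext h (X n * t))
          \<longlonglongrightarrow> zero_ext g (x * (1 - t)) * zero_ext h (x * t)"
      proof (intro AE_I2)
        fix t :: real
        show "(\<lambda>n. zero_ext g (X n * (1 - t)) * zero_ext h (X n * t))
          \<longlonglongrightarrow> zero_ext g (x * (1 - t)) * zero_ext h (x * t)"
        proof (cases "0 < t \<and> t < 1")
          case True
          have "(\<lambda>n. g (X n * (1 - t)) * h (X n * t)) \<longlonglongrightarrow> g (x * (1 - t)) * h (x * t)"
            using True xpos
            by (intro tendsto_mult isCont_tendsto_compose[where g = g] isCont_tendsto_compose[where g = h]
                gx lim tendsto_const) auto
          then show ?thesis using True pos xpos by simp
        next
          case False
          then have "z * (1 - t) \<le> 0 \<or> z * t \<le> 0" if "z > 0" for z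
            using that by (auto simp: mult_le_0_iff not_less)
          then have "zero_ext g (z * (1 - t)) * zero_ext h (z * t) = 0" if "z > 0" for z
            using that by fastforce
          then show ?thesis by (simp only: pos xpos tendsto_const)
        qed
      qed
    qed measurable
    then have "(\<lambda>n. X n * (LINT t|lborel. zero_ext g (X n * (1 - t)) * zero_ext h (X n * t)))
       \<longlonglongrightarrow> x * (LINT t|lborel. zero_ext g (x * (1 - t)) * zero_ext h (x * t))"
      by (intro tendsto_mult lim)
    then show "(conv g h \<circ> X) \<longlonglongrightarrow> conv g h x"
      by (simp add: o_def conv_scaled pos xpos)
  qed
  show ?thesis
    unfolding continuous_on_eq_continuous_at[OF open_greaterThan]
  proof
    fix x :: real assume "x \<in> {0<..}"
    then have "x \<in> interior {x / 2..x + 1}" "0 < x / 2" "x / 2 < x + 1" by auto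
    then show "isCont (conv g h) x"
      using Icc[of "x / 2" "x + 1"] by (metis continuous_on_interior)
  qed
qed

lemma power_bounded_conv:
  assumes g: "power_bounded a g" and h: "power_bounded b h" and a: "a > 0" "b > 0"
  shows "power_bounded (a + b) (conv g h)"
  unfolding power_bounded_def
proof (intro conjI allI impI)
  show "continuous_on {0<..} (conv g h)" by (rule conv_continuous[OF assms])
  fix B :: real assume B: "B > 0"
  from scaled_bound[OF g h B] obtain C where C: "C \<ge> 0" "\<And>x t. 0 < x \<Longrightarrow> x \<le> B \<Longrightarrow>
     \<bar>zero_ext g (x * (1 - t)) * zero_ext h (x * t)\<bar>
       \<le> C * x powr (a + b - 2) * (indicator {0..1} t * (t powr (b - 1) * (1 - t) powr (a - 1)))"
    by blast
  show "\<exists>C. \<forall>x\<in>{0<..B}. \<bar>conv g h x\<bar> \<le> C * x powr (a + b - 1)"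
  proof (intro exI ballI)
    fix x assume x: "x \<in> {0<..B}"
    have "\<bar>LINT t|lborel. zero_ext g (x * (1 - t)) * zero_ext h (x * t)\<bar>
       \<le> (LINT t|lborel. \<bar>zero_ext g (x * (1 - t)) * zero_ext h (x * t)\<bar>)"
      by (rule integral_abs_bound)
    also have "\<dots> \<le> (LINT t|lborel. C * x powr (a + b - 2) * (indicator {0..1} t * (t powr (b - 1) * (1 - t) powr (a - 1))))"
      using x C(2) by (intro integral_mono integrable_mult_right Beta_integrable a integrable_abs
          scaled_integrable[OF g h]) auto
    also have "\<dots> = C * x powr (a + b - 2) * Beta b a"
      using Beta_lebesgue_integral[OF a] by simp
    finally have "\<bar>conv g h x\<bar> \<le> x * (C * x powr (a + b - 2) * Beta b a)"
      using x by (simp add: conv_scaled abs_mult)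
    also have "\<dots> = (C * Beta b a) * (x powr 1 * x powr (a + b - 2))"
      using x by simp
    also have "x powr 1 * x powr (a + b - 2) = x powr (a + b - 1)"
      by (simp only: powr_add[symmetric]) simp
    finally show "\<bar>conv g h x\<bar> \<le> (C * Beta b a) * x powr (a + b - 1)" .
  qed
qed

section \<open>Semigroup law of the kernels, associativity and linearity\<close>

lemma conv_power_kernel:
  assumes a: "a > 0" "b > 0" and x: "x > 0"
  shows "conv (power_kernel a) (power_kernel b) x = power_kernel (a + b) x"
proof -
  have "(\<lambda>t. zero_ext (power_kernel a) (x * (1 - t)) * zero_ext (power_kernel b) (x * t))
     = (\<lambda>t. x powr (a + b - 2) / (Gamma a * Gamma b) * (indicator {0..1} t * (t powr (b - 1) * (1 - t) powr (a - 1))))"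
    (is "?l = ?r")
  proof
    fix t :: real
    have e: "x powr (a + b - 2) = x powr (a - 1) * x powr (b - 1)"
      by (simp add: powr_add[symmetric])
    consider "t \<le> 0" | "0 < t" "t < 1" | "t \<ge> 1" by linarith
    then show "?l t = ?r t"
    proof cases
      case 2
      then show ?thesis using x unfolding e by (simp add: power_kernel_def powr_mult)
    qed (use x in \<open>auto simp: mult_le_0_iff split: split_indicator\<close>)
  qed
  then have "conv (power_kernel a) (power_kernel b) x = x * (x powr (a + b - 2) / (Gamma a * Gamma b) * Beta b a)"
    using Beta_lebesgue_integral[OF a] by (simp add: conv_scaled[OF x])
  \<comment> \<open>The Beta value Gamma b * Gamma a / Gamma (a + b) cancels the normalisations of
    the two kernels and leaves that of order a + b.\<close>
  also have "\<dots> = (x powr 1 * x powr (a + b - 2)) / Gamma (a + b)"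
    using x a by (simp add: Beta_def add.commute)
  also have "x powr 1 * x powr (a + b - 2) = x powr (a + b - 1)"
    by (simp only: powr_add[symmetric]) simp
  finally show ?thesis by (simp only: power_kernel_def[of "a + b"])
qed

text \<open>Fubini, followed by a translation of the inner variable. The absolute integrability it
  requires comes from the same estimates applied to the absolute values.\<close>

lemma conv_assoc:
  assumes g: "power_bounded a g" and h: "power_bounded b h" and k: "power_bounded c k"
    and a: "a > 0" and b: "b > 0" and c: "c > 0"
  shows "conv g (conv h k) x = conv (conv g h) k x"
proof -
  note [measurable] = zero_ext_measurable[OF g] zero_ext_measurable[OF h] zero_ext_measurable[OF k]
  define F where "F = (\<lambda>y z. zero_ext g (x - y) * (zero_ext h (y - z) * zero_ext k z))"
  have bc: "b + c > 0" using b c by simp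
  have abs_ext: "\<bar>zero_ext u y\<bar> = zero_ext (\<lambda>x. \<bar>u x\<bar>) y" for u y
    by (auto simp: zero_ext_def abs_mult)
  have "integrable (lborel \<Otimes>\<^sub>M lborel) (case_prod F)"
  proof (rule lborel_pair.Fubini_integrable)
    show "case_prod F \<in> borel_measurable (lborel \<Otimes>\<^sub>M lborel)"
      unfolding F_def by measurable
    \<comment> \<open>The inner integral of the norms is the convolution of the absolute values of h
      and k, again power bounded of order b + c, so the outer integral is once more that of a
      convolution.\<close>
    have "integrable lborel (\<lambda>y. zero_ext (\<lambda>x. \<bar>g x\<bar>) (x - y) * zero_ext (conv (\<lambda>x. \<bar>h x\<bar>) (\<lambda>x. \<bar>k x\<bar>)) y)"
      by (intro conv_integrable[OF power_bounded_abs[OF g] power_bounded_conv[OF power_bounded_abs[OF h]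
          power_bounded_abs[OF k] b c] a bc])
    then show "integrable lborel (\<lambda>y. LINT z|lborel. norm (case_prod F (y, z)))"
      by (simp add: F_def abs_mult abs_ext conv_def[symmetric])
    show "AE y in lborel. integrable lborel (\<lambda>z. case_prod F (y, z))"
      unfolding F_def using conv_integrable[OF h k b c] by simp
  qed
  from lborel_pair.Fubini_integral[OF this]
  have "(LINT z|lborel. LINT y|lborel. F y z) = (LINT y|lborel. LINT z|lborel. F y z)" .
  moreover have "(LINT y|lborel. LINT z|lborel. F y z) = conv g (conv h k) x"
    unfolding F_def by (simp add: conv_def[of g "conv h k"]) (simp add: conv_def)
  moreover have "(LINT y|lborel. F y z) = conv g h (x - z) * zero_ext k z" for z
  proof -
    have "(LINT y|lborel. F y z) = (LINT w|lborel. F (z + 1 * w) z)"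
      by (subst lborel_integral_real_affine[where c = 1 and t = z]) auto
    also have "\<dots> = (LINT w|lborel. (zero_ext g (x - z - w) * zero_ext h w) * zero_ext k z)"
      unfolding F_def by (simp add: algebra_simps)
    also have "\<dots> = conv g h (x - z) * zero_ext k z"
      unfolding conv_def by simp
    finally show ?thesis .
  qed
  ultimately show ?thesis by (simp add: conv_def[of "conv g h" k])
qed

lemma conv_linear_right:
  assumes g: "power_bounded a g" and h: "power_bounded b h" and k: "power_bounded c k"
    and a: "a > 0" and b: "b > 0" and c: "c > 0"
  shows "conv g (\<lambda>y. p * h y + q * k y) x = p * conv g h x + q * conv g k x"
proof -
  have "zero_ext (\<lambda>y. p * h y + q * k y) y = p * zero_ext h y + q * zero_ext k y" for y
    by (simp add: zero_ext_def algebra_simps)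
  then have "conv g (\<lambda>y. p * h y + q * k y) x =
    (LINT y|lborel. p * (zero_ext g (x - y) * zero_ext h y) + q * (zero_ext g (x - y) * zero_ext k y))"
    unfolding conv_def by (simp add: algebra_simps)
  also have "\<dots> = p * conv g h x + q * conv g k x"
    unfolding conv_def using conv_integrable[OF g h a b, of x] conv_integrable[OF g k a c, of x] by simp
  finally show ?thesis .
qed

lemma conv_linear_left:
  assumes g: "power_bounded a g" and h: "power_bounded b h" and k: "power_bounded c k"
    and a: "a > 0" and b: "b > 0" and c: "c > 0"
  shows "conv (\<lambda>y. p * g y + q * h y) k x = p * conv g k x + q * conv h k x"
proof -
  have "zero_ext (\<lambda>y. p * g y + q * h y) y = p * zero_ext g y + q * zero_ext h y" for y
    by (simp add: zero_ext_def algebra_simps)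
  then have "conv (\<lambda>y. p * g y + q * h y) k x =
    (LINT y|lborel. p * (zero_ext g (x - y) * zero_ext k y) + q * (zero_ext h (x - y) * zero_ext k y))"
    unfolding conv_def by (simp add: algebra_simps)
  also have "\<dots> = p * conv g k x + q * conv h k x"
    unfolding conv_def using conv_integrable[OF g k a c, of x] conv_integrable[OF h k b c, of x] by simp
  finally show ?thesis .
qed

lemma conv_cmult_left: "conv (\<lambda>y. p * g y) h x = p * conv g h x"
  and conv_cmult_right: "conv g (\<lambda>y. p * h y) x = p * conv g h x"
proof -
  have *: "zero_ext (\<lambda>y. p * u y) y = p * zero_ext u y" for u y
    by (simp add: zero_ext_def)
  show "conv (\<lambda>y. p * g y) h x = p * conv g h x" "conv g (\<lambda>y. p * h y) x = p * conv g h x"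
    unfolding conv_def * by (simp_all add: mult.assoc mult.left_commute)
qed

section \<open>Riemann-Liouville operators as convolutions\<close>

text \<open>
  The junk value \<open>Gamma 0 = 0\<close> makes \<open>1 / Gamma 0 = 0\<close>, which agrees with the entire function
  \<open>1 / Gamma\<close>; hence \<open>power_kernel_has_derivative\<close> also covers \<open>s = 0\<close>.
\<close>

lemma power_kernel_0 [simp]: "power_kernel 0 x = 0"
  by (simp add: power_kernel_def)

lemma power_kernel_1 [simp]: "x > 0 \<Longrightarrow> power_kernel 1 x = 1"
  by (simp add: power_kernel_def)

lemma power_kernel_has_derivative:
  assumes "s \<ge> 0" "x > 0"
  shows "(power_kernel (s + 1) has_real_derivative power_kernel s x) (at x)"
proof -
  have "((\<lambda>x. x powr s / Gamma (s + 1)) has_real_derivative s * x powr (s - 1) / Gamma (s + 1)) (at x)"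
    using assms by (auto intro!: derivative_eq_intros)
  moreover have "s * x powr (s - 1) / Gamma (s + 1) = power_kernel s x"
  proof (cases "s = 0")
    case False
    then have "Gamma (s + 1) = s * Gamma s"
      using assms by (intro Gamma_plus1) (auto dest: nonpos_Ints_nonpos)
    then show ?thesis using False by (simp add: power_kernel_def)
  qed simp
  ultimately show ?thesis by (simp add: power_kernel_def[abs_def])
qed

text \<open>Convolution with the constant kernel 1 is the antiderivative starting at 0, so this is
  the fundamental theorem of calculus at a point where u is continuous.\<close>

lemma conv_power_kernel_1_has_derivative:
  assumes u: "power_bounded a u" and a: "a > 0" and x: "x > 0"
  shows "(conv (power_kernel 1) u has_real_derivative u x) (at x)"
proof -
  \<comment> \<open>As u may be singular at 0, the fundamental theorem is applied from a base point
    inside (0, x); the integral over (0, d] only adds a constant.\<close>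
  define d where "d = x / 2"
  have d: "0 < d" "d < x" using x by (auto simp: d_def)
  have int: "set_integrable lborel {0<..y} u" for y
  proof -
    have "integrable lborel (\<lambda>z. zero_ext (power_kernel 1) (y - z) * zero_ext u z)"
      by (rule conv_integrable[OF power_bounded_power_kernel u _ a]) simp
    \<comment> \<open>At z = y the shifted kernel takes the cut-off value 0, while the indicator
      still counts the endpoint; a single point does not affect the integral.\<close>
    also have "?this \<longleftrightarrow> integrable lborel (\<lambda>z. indicator {0<..y} z * u z)"
      by (rule integrable_discrete_difference[where X = "{y}"])
        (auto simp: zero_ext_def split: split_indicator)
    finally show ?thesis by (simp add: set_integrable_def)
  qed
  have eq: "conv (power_kernel 1) u y = (LBINT z:{0<..y}. u z)" for y
  proof -
    have "conv (power_kernel 1) u y = (LINT z|lborel. indicator {0<..y} z * u z)"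
      unfolding conv_def
      by (rule integral_discrete_difference[where X = "{y}"])
        (auto simp: zero_ext_def split: split_indicator)
    then show ?thesis by (simp add: set_lebesgue_integral_def)
  qed
  have split: "conv (power_kernel 1) u y = conv (power_kernel 1) u d + (LBINT z=d..y. u z)"
    if "y \<ge> d" for y
  proof -
    have "{0<..y} = {0<..d} \<union> {d<..y}" using that d by auto
    then have "(LBINT z:{0<..y}. u z) = (LBINT z:{0<..d}. u z) + (LBINT z:{d<..y}. u z)"
      using set_integrable_subset[OF int[of y], of "{d<..y}"] d
      by (simp add: set_integral_Un[OF _ int] subset_iff)
    also have "(LBINT z:{d<..y}. u z) = (LBINT z=d..y. u z)"
      using that by (simp add: interval_integral_Ioc)
    finally show ?thesis by (simp add: eq)
  qed
  have "((\<lambda>y. LBINT z=d..y. u z) has_vector_derivative u x) (at x within {d..x + 1})"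
    using d u by (intro interval_integral_FTC2)
      (auto simp: power_bounded_def intro: continuous_on_subset)
  then have "((\<lambda>y. LBINT z=d..y. u z) has_real_derivative u x) (at x)"
    using d at_within_Icc_at[of d x "x + 1"]
    by (simp only: has_real_derivative_iff_has_vector_derivative)
  then have "((\<lambda>y. conv (power_kernel 1) u d + (LBINT z=d..y. u z)) has_real_derivative u x) (at x)"
    by (auto intro!: derivative_eq_intros)
  moreover have "\<forall>\<^sub>F y in nhds x. conv (power_kernel 1) u d + (LBINT z=d..y. u z) = conv (power_kernel 1) u y"
  proof (rule eventually_mono)
    show "\<forall>\<^sub>F y in nhds x. y > d"
      using d eventually_nhds_in_open[of "{d<..}" x] by simp
  qed (simp add: split[symmetric])
  ultimately show ?thesis
    by (rule DERIV_cong_ev[OF refl _ refl, THEN iffD1, rotated])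
qed

lemma RL_kernel_integral_eq_conv:
  "RL_kernel_integral s f x = conv (\<lambda>y. y powr (s - 1)) f x"
  unfolding RL_kernel_integral_def set_lebesgue_integral_def conv_def
  \<comment> \<open>The closed interval and the two zero extensions can disagree only at the
    endpoints 0 and x.\<close>
  by (rule integral_discrete_difference[where X = "{0, x}"])
    (auto simp: zero_ext_def split: split_indicator)

lemma powr_eq_power_kernel: "s > 0 \<Longrightarrow> x powr (s - 1) = Gamma s * power_kernel s x"
  by (simp add: power_kernel_def)

lemma RL_kernel_integral_eq:
  "s > 0 \<Longrightarrow> RL_kernel_integral s f x = Gamma s * conv (power_kernel s) f x"
  by (simp add: RL_kernel_integral_eq_conv powr_eq_power_kernel conv_cmult_left)

lemma RL_integral_eq_conv: "s > 0 \<Longrightarrow> RL_integral s f x = conv (power_kernel s) f x"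
  by (simp add: RL_integral_def RL_kernel_integral_eq)

lemma RL_integrable_power_bounded:
  assumes "power_bounded a f" "a > 0" "s > 0"
  shows "RL_integrable s f"
  unfolding RL_integrable_def
proof safe
  fix x :: real
  have "integrable lborel (\<lambda>y. zero_ext (\<lambda>y. y powr (s - 1)) (x - y) * zero_ext f y)"
    by (rule conv_integrable[OF power_bounded_powr assms(1,3,2)])
  also have "?this \<longleftrightarrow> integrable lborel (\<lambda>y. indicator {0..x} y *\<^sub>R ((x - y) powr (s - 1) * f y))"
    by (rule integrable_discrete_difference[where X = "{0, x}"])
      (auto simp: zero_ext_def split: split_indicator)
  finally show "set_integrable lborel {0..x} (\<lambda>y. (x - y) powr (s - 1) * f y)"
    by (simp add: set_integrable_def)
qed

lemma conv_power_kernel_power_kernel: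
  assumes "power_bounded a u" "a > 0" "s > 0" "t > 0"
  shows "conv (power_kernel s) (conv (power_kernel t) u) x = conv (power_kernel (s + t)) u x"
proof -
  have "conv (power_kernel s) (conv (power_kernel t) u) x = conv (conv (power_kernel s) (power_kernel t)) u x"
    by (rule conv_assoc[OF power_bounded_power_kernel power_bounded_power_kernel assms(1,3,4,2)])
  also have "conv (conv (power_kernel s) (power_kernel t)) u = conv (power_kernel (s + t)) u"
    using assms by (intro conv_cong conv_power_kernel) auto
  finally show ?thesis .
qed

text \<open>\<open>F\<close> is a ladder of successive antiderivatives, descended one rung per
  derivative. Agreement of \<open>G\<close> with the top rung on x > 0 is enough, because a
  derivative depends only on values near the point and the half-line is open.\<close>

lemma funpow_deriv_chain:
  fixes G :: "real \<Rightarrow> real" and F :: "nat \<Rightarrow> real \<Rightarrow> real"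
  assumes F: "\<And>j x. j < N \<Longrightarrow> x > 0 \<Longrightarrow> (F (Suc j) has_real_derivative F j x) (at x)"
    and G: "\<And>x. x > 0 \<Longrightarrow> G x = F N x"
  shows "k \<le> N \<Longrightarrow> x > 0 \<Longrightarrow> (deriv ^^ k) G x = F (N - k) x"
    and "k < N \<Longrightarrow> x > 0 \<Longrightarrow> (deriv ^^ k) G differentiable (at x)"
proof -
  have der: "((deriv ^^ k) G has_real_derivative F (N - Suc k) x) (at x)"
    if "k < N" "x > 0" "\<And>y. y > 0 \<Longrightarrow> (deriv ^^ k) G y = F (N - k) y" for k x
  proof -
    have "\<forall>\<^sub>F y in nhds x. (deriv ^^ k) G y = F (Suc (N - Suc k)) y"
      using that eventually_nhds_in_open[of "{0<..}" x] by (auto elim!: eventually_mono simp: Suc_diff_Suc)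
    then show ?thesis
      using F[of "N - Suc k" x] that by (subst DERIV_cong_ev[OF refl _ refl]) auto
  qed
  have all: "\<forall>x>0. (deriv ^^ k) G x = F (N - k) x" if "k \<le> N" for k
    using that
  proof (induction k)
    case (Suc k)
    then show ?case using der[of k] by (auto intro!: DERIV_imp_deriv)
  qed (use G in auto)
  then show "k \<le> N \<Longrightarrow> x > 0 \<Longrightarrow> (deriv ^^ k) G x = F (N - k) x" by blast
  show "k < N \<Longrightarrow> x > 0 \<Longrightarrow> (deriv ^^ k) G differentiable (at x)"
    using der[of k x] all[of k] by (auto simp: real_differentiable_def)
qed

text \<open>The floor plus one exceeds r strictly even for integer r, so the kernel integral inside
  the derivative always has positive order.\<close>

lemma RL_order_gt: "r > 0 \<Longrightarrow> real (RL_order r) - r > 0"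
  by (simp add: RL_order_def) linarith

text \<open>Formally f is I^r applied to u plus c times a Dirac mass at 0. Applying I^(N - r) lifts
  both terms to the integer order N, from which N ordinary derivatives descend to u; the Dirac term
  is invisible on x > 0.\<close>

lemma RL_deriv_inverts:
  assumes u: "power_bounded a u" and a: "a > 0" and r: "r > 0"
    and f: "\<And>x. x > 0 \<Longrightarrow> f x = c * power_kernel r x + conv (power_kernel r) u x"
  shows "RL_defined r f" "x > 0 \<Longrightarrow> RL_deriv r f x = u x"
proof -
  define N where "N = RL_order r"
  define s where "s = real N - r"
  have s: "s > 0" using RL_order_gt[OF r] by (simp add: s_def N_def)
  have N: "N > 0" by (simp add: N_def RL_order_def)
  \<comment> \<open>Rung j is the j-fold integral of u plus c times a Dirac mass. The factor
    \<open>Gamma s\<close> cancels the normalisation in \<open>RL_deriv\<close>. Rung 0 is split off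
    because \<open>power_kernel 0\<close> is the zero function, so that convolving with it would
    give 0 in place of u.\<close>
  define F where "F = (\<lambda>j x. Gamma s * (c * power_kernel (real j) x +
      (if j = 0 then u x else conv (power_kernel (real j)) u x)))"
  have conv_pb: "power_bounded (t + a) (conv (power_kernel t) u)" if "t > 0" for t
    using power_bounded_conv[OF power_bounded_power_kernel u that a] .
  have fpb: "power_bounded r f"
  proof (rule power_bounded_cong[OF _ f])
    show "power_bounded r (\<lambda>x. c * power_kernel r x + conv (power_kernel r) u x)"
      by (intro power_bounded_add power_bounded_weaken[OF conv_pb[OF r]]
          power_bounded_cmult power_bounded_power_kernel) (use a in auto)
  qed
  have int: "RL_integrable s f"
    by (rule RL_integrable_power_bounded[OF fpb r s])
  have G: "RL_kernel_integral s f x = F N x" if "x > 0" for x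
  proof -
    have "conv (power_kernel s) f x = conv (power_kernel s) (\<lambda>x. c * power_kernel r x + 1 * conv (power_kernel r) u x) x"
      using f by (intro fun_cong[OF conv_cong]) auto
    also have "\<dots> = c * conv (power_kernel s) (power_kernel r) x + 1 * conv (power_kernel s) (conv (power_kernel r) u) x"
      using r s a by (intro conv_linear_right[OF power_bounded_power_kernel power_bounded_power_kernel conv_pb]) auto
    also have "\<dots> = c * power_kernel (s + r) x + conv (power_kernel (s + r)) u x"
      using r s a that by (simp add: conv_power_kernel conv_power_kernel_power_kernel[OF u])
    also have "s + r = real N" by (simp add: s_def)
    finally show ?thesis using s N by (simp add: RL_kernel_integral_eq F_def)
  qed
  have F: "(F (Suc j) has_real_derivative F j x) (at x)" if x: "x > 0" for j x
  proof -
    have "(conv (power_kernel (real (Suc j))) u has_real_derivative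
        (if j = 0 then u x else conv (power_kernel (real j)) u x)) (at x)"
    proof (cases "j = 0")
      case True
      then show ?thesis using conv_power_kernel_1_has_derivative[OF u a x] by simp
    next
      case False
      then have "conv (power_kernel (real (Suc j))) u = conv (power_kernel 1) (conv (power_kernel (real j)) u)"
        using a by (intro ext, subst conv_power_kernel_power_kernel[OF u]) auto
      then show ?thesis
        using conv_power_kernel_1_has_derivative[OF conv_pb[of "real j"] _ x] False a by simp
    qed
    moreover have "(power_kernel (real (Suc j)) has_real_derivative power_kernel (real j) x) (at x)"
      using power_kernel_has_derivative[of "real j" x] x by (simp add: add.commute)
    ultimately show ?thesis
      unfolding F_def by (auto intro!: derivative_eq_intros)
  qed
  show "RL_defined r f"
    using r int funpow_deriv_chain(2)[of N F "RL_kernel_integral s f", OF F G]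
    by (simp add: RL_defined_def N_def[symmetric] s_def[symmetric])
  show "RL_deriv r f x = u x" if "x > 0"
    using funpow_deriv_chain(1)[of N F "RL_kernel_integral s f" N x, OF F G] r that s
    by (simp add: RL_deriv_def N_def[symmetric] s_def[symmetric] F_def)
qed

section \<open>Mittag-Leffler and gamma densities\<close>

text \<open>Restrict Euler's integral to [A, A + 1] and bound its integrand below there. As A is
  arbitrary, Gamma outgrows every geometric sequence.\<close>

lemma Gamma_ge_powr:
  fixes A y :: real
  assumes A: "A > 0" and y: "y \<ge> 1"
  shows "Gamma y \<ge> A powr (y - 1) / exp (A + 1)"
proof -
  let ?c = "A powr (y - 1) / exp (A + 1)"
  have "((\<lambda>t. ?c) has_integral ?c) {A..A + 1}"
    using has_integral_const_real[of ?c A "A + 1"] by simp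
  then have "((\<lambda>t. if t \<in> {A..A + 1} then ?c else 0) has_integral ?c) {0..}"
    using A by (subst has_integral_restrict) auto
  moreover have "((\<lambda>t. t powr (y - 1) / exp t) has_integral Gamma y) {0..}"
    using y by (intro Gamma_integral_real) simp
  ultimately show ?thesis
  proof (rule has_integral_le)
    fix t :: real assume "t \<in> {0..}"
    show "(if t \<in> {A..A + 1} then ?c else 0) \<le> t powr (y - 1) / exp t"
    proof (cases "t \<in> {A..A + 1}")
      case True
      then have "?c \<le> t powr (y - 1) / exp t"
        using A y by (intro frac_le powr_mono2) auto
      then show ?thesis using True by simp
    qed auto
  qed
qed

lemma mittag_leffler_summable:
  assumes "\<mu> > 0" "\<nu> > 0"
  shows "summable (\<lambda>k. z ^ k / Gamma (\<mu> * real k + \<nu>))"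
proof -
  \<comment> \<open>Chosen so that A powr \<mu> is 2 * (\<bar>z\<bar> + 1), which makes the ratio of
    the geometric majorant at most 1/2.\<close>
  define A where "A = (2 * (\<bar>z\<bar> + 1)) powr (1 / \<mu>)"
  have A: "A > 0" by (simp add: A_def add_nonneg_eq_0_iff)
  have Amu: "A powr \<mu> = 2 * (\<bar>z\<bar> + 1)"
    using assms by (simp add: A_def powr_powr)
  define C where "C = exp (A + 1) * A powr (1 - \<nu>)"
  \<comment> \<open>From this index on the argument of Gamma is at least 1, as the lower bound
    demands.\<close>
  have "\<forall>\<^sub>F k in sequentially. real k \<ge> 1 / \<mu>"
    using real_arch_simple[of "1 / \<mu>"] by (metis eventually_sequentially of_nat_le_iff order_trans)
  then have "\<forall>\<^sub>F k in sequentially. norm (z ^ k / Gamma (\<mu> * real k + \<nu>)) \<le> C * (1 / 2) ^ k"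
  proof eventually_elim
    case (elim k)
    define y where "y = \<mu> * real k + \<nu>"
    have y: "y \<ge> 1" using elim assms by (simp add: y_def field_simps)
    have pos: "0 < A powr (y - 1) / exp (A + 1)" using A by simp
    have "norm (z ^ k / Gamma y) = \<bar>z\<bar> ^ k / Gamma y"
      using y by (simp add: abs_mult power_abs Gamma_real_pos less_imp_le)
    also have "\<dots> \<le> \<bar>z\<bar> ^ k / (A powr (y - 1) / exp (A + 1))"
      using Gamma_ge_powr[OF A y] pos by (intro divide_left_mono mult_pos_pos) auto
    also have "A powr (y - 1) = (A powr \<mu>) ^ k * A powr (\<nu> - 1)"
      using A by (simp add: y_def powr_powr powr_add[symmetric] flip: powr_realpow)
        (simp add: algebra_simps)
    also have "\<bar>z\<bar> ^ k / ((A powr \<mu>) ^ k * A powr (\<nu> - 1) / exp (A + 1))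
        = C * (\<bar>z\<bar> / (A powr \<mu>)) ^ k"
      using A by (simp add: C_def powr_diff power_divide field_simps)
    also have "\<dots> \<le> C * (1 / 2) ^ k"
      unfolding Amu using A by (intro mult_left_mono power_mono) (auto simp: C_def field_simps)
    finally show ?case by (simp add: y_def)
  qed
  then show ?thesis
    by (rule summable_comparison_test_ev) (intro summable_mult summable_geometric, simp)
qed

lemma mittag_leffler_continuous:
  assumes "\<mu> > 0" "\<nu> > 0"
  shows "isCont (mittag_leffler \<mu> \<nu>) z"
proof -
  have "isCont (\<lambda>x. \<Sum>k. inverse (Gamma (\<mu> * real k + \<nu>)) * x ^ k) z"
    using mittag_leffler_summable[OF assms]
    by (intro isCont_powser_converges_everywhere) (simp add: divide_inverse mult.commute)
  then show ?thesis
    by (simp add: mittag_leffler_def[abs_def] divide_inverse mult.commute)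
qed

lemma power_bounded_mittag_leffler_density:
  assumes "\<mu> > 0"
  shows "power_bounded \<mu> (mittag_leffler_density \<mu> l)"
proof (rule power_bounded_cong)
  have E: "continuous_on UNIV (mittag_leffler \<mu> \<mu>)"
    using mittag_leffler_continuous[OF assms assms] by (simp add: continuous_on_eq_continuous_at)
  have "continuous_on {0..} (\<lambda>x. x powr \<mu>)"
    using assms by (intro continuous_on_powr') auto
  then have "continuous_on {0..} (\<lambda>x. - l * x powr \<mu>)"
    by (intro continuous_on_mult continuous_on_const)
  then have "continuous_on {0..} (\<lambda>x. l * mittag_leffler \<mu> \<mu> (- l * x powr \<mu>))"
    by (rule continuous_on_mult[OF continuous_on_const continuous_on_compose2[OF E]]) auto
  then show "power_bounded \<mu> (\<lambda>x. (l * mittag_leffler \<mu> \<mu> (- l * x powr \<mu>)) * x powr (\<mu> - 1))"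
    by (rule power_bounded_times_continuous[OF power_bounded_powr])
qed (simp add: mittag_leffler_density_def)

text \<open>Written in power kernels of orders \<mu>, 2\<mu>, 3\<mu> and so on, the density becomes
  a series on which convolution with \<open>power_kernel \<mu>\<close> acts as an index
  shift.\<close>

lemma mittag_leffler_density_sums:
  assumes "\<mu> > 0" "x > 0"
  shows "(\<lambda>k. l * (- l) ^ k * power_kernel (\<mu> * real k + \<mu>) x) sums mittag_leffler_density \<mu> l x"
proof -
  have "(\<lambda>k. (- l * x powr \<mu>) ^ k / Gamma (\<mu> * real k + \<mu>)) sums mittag_leffler \<mu> \<mu> (- l * x powr \<mu>)"
    unfolding mittag_leffler_def using mittag_leffler_summable[OF assms(1,1)] by (rule summable_sums)
  from sums_mult[OF this, of "l * x powr (\<mu> - 1)"]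
  have "(\<lambda>k. l * x powr (\<mu> - 1) * ((- l * x powr \<mu>) ^ k / Gamma (\<mu> * real k + \<mu>))) sums
      mittag_leffler_density \<mu> l x"
    using assms by (simp add: mittag_leffler_density_def)
  moreover have "x powr (\<mu> - 1) * (x powr \<mu>) ^ k = x powr (\<mu> * real k + \<mu> - 1)" for k
    using assms by (simp add: powr_powr powr_add[symmetric] algebra_simps flip: powr_realpow)
  then have "l * x powr (\<mu> - 1) * ((- l * x powr \<mu>) ^ k / Gamma (\<mu> * real k + \<mu>))
      = l * (- l) ^ k * power_kernel (\<mu> * real k + \<mu>) x" for k
    by (simp only: power_kernel_def power_mult_distrib) (simp add: mult_ac flip: mult.assoc)
  ultimately show ?thesis by simp
qed

text \<open>Convolving with the kernel shifts the series by one index, and multiplication by -l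
  restores the coefficients. The result is the series without its first term, l *
  \<open>power_kernel \<mu>\<close>. The work lies in exchanging sum and integral.\<close>

lemma mittag_leffler_density_volterra:
  assumes mu: "\<mu> > 0" and x: "x > 0"
  shows "mittag_leffler_density \<mu> l x =
    l * power_kernel \<mu> x - l * conv (power_kernel \<mu>) (mittag_leffler_density \<mu> l) x"
proof -
  let ?p = "\<lambda>k. power_kernel (\<mu> * real k + \<mu>)"
  define w where "w = (\<lambda>k y. zero_ext (power_kernel \<mu>) (x - y) * zero_ext (?p k) y)"
  have arg: "\<mu> * real k + \<mu> > 0" for k using mu by (simp add: add_nonneg_pos)
  have w_int: "integrable lborel (w k)" for k
    unfolding w_def using mu arg by (intro conv_integrable[OF power_bounded_power_kernel power_bounded_power_kernel])
  have w_val: "(LINT y|lborel. w k y) = ?p (Suc k) x" for k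
    using conv_power_kernel[OF mu arg[of k] x] by (simp add: w_def conv_def algebra_simps)
  have w_nonneg: "w k y \<ge> 0" for k y
    using mu arg by (auto simp: w_def zero_ext_def power_kernel_def Gamma_real_pos less_imp_le
        intro!: mult_nonneg_nonneg divide_nonneg_nonneg)
  \<comment> \<open>Up to sign, the absolute values form the series of the same density with
    parameter -\<bar>l\<bar>.\<close>
  have abs_summable: "summable (\<lambda>k. \<bar>l\<bar> * \<bar>l\<bar> ^ k * ?p k y)" if "y > 0" for y
    using sums_summable[OF mittag_leffler_density_sums[OF mu that, of "- \<bar>l\<bar>"]]
    by (simp add: summable_minus_iff)
  have "(\<lambda>k. l * (- l) ^ k * ?p (Suc k) x) sums conv (power_kernel \<mu>) (mittag_leffler_density \<mu> l) x"
  proof -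
    have "(\<lambda>k. LINT y|lborel. l * (- l) ^ k * w k y) sums (LINT y|lborel. (\<Sum>k. l * (- l) ^ k * w k y))"
    proof (rule sums_integral)
      show "integrable lborel (\<lambda>y. l * (- l) ^ k * w k y)" for k
        by (intro integrable_mult_right w_int)
      have "summable (\<lambda>k. norm (l * (- l) ^ k * w k y))" for y
      proof (cases "y > 0")
        case True
        have "norm (l * (- l) ^ k * w k y) = zero_ext (power_kernel \<mu>) (x - y) * (\<bar>l\<bar> * \<bar>l\<bar> ^ k * ?p k y)" for k
          using w_nonneg[of k y] True by (simp add: abs_mult power_abs) (simp add: w_def mult_ac)
        then show ?thesis using summable_mult[OF abs_summable[OF True]] by simp
      qed (simp add: w_def)
      then show "AE y in lborel. summable (\<lambda>k. norm (l * (- l) ^ k * w k y))" by simp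
      have "(LINT y|lborel. norm (l * (- l) ^ k * w k y)) = \<bar>l\<bar> * \<bar>l\<bar> ^ k * ?p (Suc k) x" for k
        using w_nonneg by (simp add: abs_mult power_abs w_val)
      moreover have "summable (\<lambda>k. \<bar>l\<bar> * \<bar>l\<bar> ^ k * ?p (Suc k) x)"
      \<comment> \<open>The shifted series carries one power of \<bar>l\<bar> too many, which has to
        be divided out.\<close>
      proof (cases "l = 0")
        case False
        have "summable (\<lambda>k. \<bar>l\<bar> * \<bar>l\<bar> ^ Suc k * ?p (Suc k) x)"
          using abs_summable[OF x] by (subst summable_Suc_iff)
        from summable_mult[OF this, of "1 / \<bar>l\<bar>"]
        moreover have "1 / \<bar>l\<bar> * (\<bar>l\<bar> * \<bar>l\<bar> ^ Suc k * ?p (Suc k) x) = \<bar>l\<bar> * \<bar>l\<bar> ^ k * ?p (Suc k) x" for k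
          using False by simp
        ultimately show ?thesis by simp
      qed simp
      ultimately show "summable (\<lambda>k. LINT y|lborel. norm (l * (- l) ^ k * w k y))" by simp
    qed
    moreover have "(\<Sum>k. l * (- l) ^ k * w k y) =
        zero_ext (power_kernel \<mu>) (x - y) * zero_ext (mittag_leffler_density \<mu> l) y" for y
    proof (cases "y > 0")
      case True
      from sums_mult[OF mittag_leffler_density_sums[OF mu True, of l], of "zero_ext (power_kernel \<mu>) (x - y)"]
      show ?thesis using True by (simp add: sums_iff w_def mult_ac)
    qed (simp add: w_def)
    ultimately show ?thesis by (simp add: w_val conv_def)
  qed
  from sums_mult[OF this, of "- l"]
  have "(\<lambda>k. l * (- l) ^ Suc k * ?p (Suc k) x) sums (- l * conv (power_kernel \<mu>) (mittag_leffler_density \<mu> l) x)"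
    by (simp add: mult_ac)
  then have "(\<lambda>k. l * (- l) ^ k * ?p k x) sums
    (- l * conv (power_kernel \<mu>) (mittag_leffler_density \<mu> l) x + l * (- l) ^ 0 * ?p 0 x)"
    by (subst (asm) sums_Suc_iff) simp
  from sums_unique2[OF this mittag_leffler_density_sums[OF mu x]] show ?thesis by simp
qed

section \<open>Operators that undo convolution with a density\<close>

text \<open>
  \<open>L\<close> undoes convolution with \<open>g\<close> up to the factor \<open>k\<close>; the first clause is the case where the
  other convolution factor is a Dirac mass at \<open>0\<close>, which \<open>L\<close> maps to zero on the open half-line.
\<close>

definition inverts ::
    "((real \<Rightarrow> real) \<Rightarrow> bool) \<Rightarrow> ((real \<Rightarrow> real) \<Rightarrow> real \<Rightarrow> real) \<Rightarrow> (real \<Rightarrow> real) \<Rightarrow> real \<Rightarrow> bool" where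
  "inverts D L g k \<longleftrightarrow> (\<forall>f c.
     ((\<forall>x>0. f x = c * g x) \<longrightarrow> D f \<and> (\<forall>x>0. L f x = 0)) \<and>
     (\<forall>b h. b > 0 \<longrightarrow> power_bounded b h \<longrightarrow> (\<forall>x>0. f x = c * conv g h x) \<longrightarrow>
        D f \<and> (\<forall>x>0. L f x = c * k * h x)))"

lemma conv_zero_right [simp]: "conv g (\<lambda>y. 0) x = 0"
  by (simp add: conv_def zero_ext_def)

lemma power_bounded_zero: "power_bounded a (\<lambda>x. 0)"
  using power_bounded_cmult[OF power_bounded_powr, of a 0] by simp

lemma power_bounded_gamma_density: "power_bounded r (gamma_density r l)"
proof (rule power_bounded_cong)
  show "power_bounded r (\<lambda>x. (l powr r / Gamma r * exp (- l * x)) * x powr (r - 1))"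
    by (rule power_bounded_times_continuous[OF power_bounded_powr]) (intro continuous_intros)
qed (simp add: gamma_density_def)

text \<open>The weight exp (l * y) turns the gamma density into l powr r times the power kernel. It
  passes through convolutions because it factors as exp (l * (y - z)) * exp (l * z), so the weighted
  problem is the unweighted inversion.\<close>

lemma inverts_gamma_density:
  assumes r: "r > 0"
  shows "inverts (R_defined l r) (R_op l r) (gamma_density r l) (l powr r)"
  unfolding inverts_def
proof (intro allI conjI impI)
  fix f :: "real \<Rightarrow> real" and c :: real
  assume f: "\<forall>x>0. f x = c * gamma_density r l x"
  let ?F = "\<lambda>y. exp (l * y) * f y"
  \<comment> \<open>A pure kernel term: the function to be recovered is 0, for which any positive
    order serves.\<close>
  have F: "?F y = (c * l powr r) * power_kernel r y + conv (power_kernel r) (\<lambda>y. 0) y" if "y > 0" for y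
    using that f by (simp add: gamma_density_def power_kernel_def exp_minus field_simps)
  show "R_defined l r f"
    unfolding R_defined_def by (rule RL_deriv_inverts(1)[OF power_bounded_zero zero_less_one r F])
  show "R_op l r f x = 0" if "x > 0" for x
    using RL_deriv_inverts(2)[OF power_bounded_zero zero_less_one r F that] by (simp add: R_op_def)
next
  fix f h :: "real \<Rightarrow> real" and c b :: real
  assume b: "b > 0" and h: "power_bounded b h" and f: "\<forall>x>0. f x = c * conv (gamma_density r l) h x"
  let ?F = "\<lambda>y. exp (l * y) * f y"
  let ?u = "\<lambda>y. (c * l powr r * exp (l * y)) * h y"
  have u: "power_bounded b ?u"
    by (rule power_bounded_times_continuous[OF h]) (intro continuous_intros)
  have F: "?F y = 0 * power_kernel r y + conv (power_kernel r) ?u y" if "y > 0" for y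
  proof -
    have "zero_ext (power_kernel r) (y - z) * zero_ext ?u z =
       (c * exp (l * y)) * (zero_ext (gamma_density r l) (y - z) * zero_ext h z)" for z
      by (auto simp: zero_ext_def power_kernel_def gamma_density_def exp_minus exp_diff right_diff_distrib
          split: split_indicator)
    then show ?thesis using that f by (simp add: conv_def)
  qed
  show "R_defined l r f"
    unfolding R_defined_def by (rule RL_deriv_inverts(1)[OF u b r F])
  show "R_op l r f x = c * l powr r * h x" if "x > 0" for x
    using RL_deriv_inverts(2)[OF u b r F that] by (simp add: R_op_def exp_minus)
qed

text \<open>Convolve the Volterra equation with h and factor out the kernel. This exhibits the
  convolution as a fractional integral of order \<mu> without a Dirac term.\<close>

lemma conv_mittag_leffler_density:
  assumes mu: "\<mu> > 0" and h: "power_bounded b h" and b: "b > 0"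
  shows "conv (mittag_leffler_density \<mu> l) h x =
    conv (power_kernel \<mu>) (\<lambda>y. l * h y + (- l) * conv (mittag_leffler_density \<mu> l) h y) x"
proof -
  let ?g = "mittag_leffler_density \<mu> l"
  note g = power_bounded_mittag_leffler_density[OF mu, of l]
  note p = power_bounded_power_kernel[of \<mu>]
  have "conv ?g h x = conv (\<lambda>y. l * power_kernel \<mu> y + (- l) * conv (power_kernel \<mu>) ?g y) h x"
    using mittag_leffler_density_volterra[OF mu] by (intro fun_cong[OF conv_cong]) auto
  also have "\<dots> = l * conv (power_kernel \<mu>) h x + (- l) * conv (conv (power_kernel \<mu>) ?g) h x"
    using mu b by (intro conv_linear_left[OF p power_bounded_conv[OF p g] h]) auto
  also have "conv (conv (power_kernel \<mu>) ?g) h x = conv (power_kernel \<mu>) (conv ?g h) x"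
    by (rule conv_assoc[OF p g h mu mu b, symmetric])
  also have "l * conv (power_kernel \<mu>) h x + (- l) * \<dots> =
      conv (power_kernel \<mu>) (\<lambda>y. l * h y + (- l) * conv ?g h y) x"
    using mu b by (intro conv_linear_right[symmetric, OF p h power_bounded_conv[OF g h]]) auto
  finally show ?thesis .
qed

text \<open>On a multiple f of the density the Volterra equation yields -l * f as the fractional
  derivative, cancelled by the summand l * f. After convolution with h the same cancellation leaves
  l * h.\<close>

lemma inverts_mittag_leffler_density:
  assumes mu: "\<mu> > 0"
  shows "inverts (RL_defined \<mu>) (RL_deriv_plus \<mu> l) (mittag_leffler_density \<mu> l) l"
  unfolding inverts_def
proof (intro allI conjI impI)
  let ?g = "mittag_leffler_density \<mu> l"
  note g = power_bounded_mittag_leffler_density[OF mu, of l]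
  fix f :: "real \<Rightarrow> real" and c :: real
  assume f: "\<forall>x>0. f x = c * ?g x"
  have u: "power_bounded \<mu> (\<lambda>y. (- c * l) * ?g y)" by (rule power_bounded_cmult[OF g])
  have F: "f y = (c * l) * power_kernel \<mu> y + conv (power_kernel \<mu>) (\<lambda>y. (- c * l) * ?g y) y" if "y > 0" for y
    using that f arg_cong[OF mittag_leffler_density_volterra[OF mu that, of l], of "\<lambda>z. c * z"]
    unfolding conv_cmult_right by (simp add: right_diff_distrib mult.assoc)
  show "RL_defined \<mu> f" by (rule RL_deriv_inverts(1)[OF u mu mu F])
  show "RL_deriv_plus \<mu> l f x = 0" if "x > 0" for x
    using RL_deriv_inverts(2)[OF u mu mu F that] f that by (simp add: RL_deriv_plus_def)
next
  let ?g = "mittag_leffler_density \<mu> l"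
  note g = power_bounded_mittag_leffler_density[OF mu, of l]
  fix f h :: "real \<Rightarrow> real" and c b :: real
  assume b: "b > 0" and h: "power_bounded b h" and f: "\<forall>x>0. f x = c * conv ?g h x"
  let ?u = "\<lambda>y. c * (l * h y + (- l) * conv ?g h y)"
  have u: "power_bounded b ?u"
    using mu by (intro power_bounded_cmult power_bounded_add h
        power_bounded_weaken[OF power_bounded_conv[OF g h mu b]]) auto
  have F: "f y = 0 * power_kernel \<mu> y + conv (power_kernel \<mu>) ?u y" if "y > 0" for y
    using that f conv_mittag_leffler_density[OF mu h b, of l y] unfolding conv_cmult_right by simp
  show "RL_defined \<mu> f" by (rule RL_deriv_inverts(1)[OF u b mu F])
  show "RL_deriv_plus \<mu> l f x = c * l * h x" if "x > 0" for x
    using RL_deriv_inverts(2)[OF u b mu F that] f that by (simp add: RL_deriv_plus_def algebra_simps)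
qed

section \<open>Boundary behaviour at the origin\<close>

lemma power_bounded_tendsto_0:
  assumes g: "power_bounded a g" and a: "a > 1"
  shows "(g \<longlongrightarrow> 0) (at_right 0)"
proof -
  from power_boundedE[OF g zero_less_one] obtain C where
    C: "\<And>x. x > 0 \<Longrightarrow> x \<le> 1 \<Longrightarrow> \<bar>g x\<bar> \<le> C * x powr (a - 1)" by blast
  have "((\<lambda>x. x powr (a - 1)) \<longlongrightarrow> 0 powr (a - 1)) (at_right 0)"
    using a by (intro tendsto_powr' tendsto_intros) (auto simp: eventually_at_filter)
  then have lim: "((\<lambda>x. C * x powr (a - 1)) \<longlongrightarrow> 0) (at_right 0)"
    by (auto intro: tendsto_mult_right_zero)
  have "\<forall>\<^sub>F x in at_right 0. norm (g x) \<le> C * x powr (a - 1)"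
    using eventually_at_right_real[OF zero_less_one] by eventually_elim (auto intro: C)
  then show ?thesis using lim by (rule Lim_null_comparison)
qed

text \<open>Integration of order 1 - \<mu> raises the singular leading kernel of the Volterra
  equation to order 1, a constant. The remainder is an ordinary antiderivative of the density, of
  power order 1 + \<mu>, and vanishes at 0.\<close>

lemma RL_deriv_mittag_leffler_density_at_0:
  assumes mu: "0 < \<mu>" "\<mu> \<le> 1" and f: "\<And>x. x > 0 \<Longrightarrow> f x = c * mittag_leffler_density \<mu> l x"
  shows "RL_defined (\<mu> - 1) f" "(RL_deriv (\<mu> - 1) f \<longlongrightarrow> c * l) (at_right 0)"
proof -
  let ?g = "mittag_leffler_density \<mu> l"
  note g = power_bounded_mittag_leffler_density[OF mu(1), of l]
  note p = power_bounded_power_kernel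
  have fpb: "power_bounded \<mu> f"
    by (rule power_bounded_cong[OF power_bounded_cmult[OF g] f])
  show "RL_defined (\<mu> - 1) f"
    using RL_integrable_power_bounded[OF fpb mu(1), of "1 - \<mu>"] mu by (auto simp: RL_defined_def)
  have f': "f x = (c * l) * power_kernel \<mu> x + (- (c * l)) * conv (power_kernel \<mu>) ?g x" if x: "x > 0" for x
    using f[OF x] arg_cong[OF mittag_leffler_density_volterra[OF mu(1) x, of l], of "\<lambda>z. c * z"]
    by (simp add: right_diff_distrib mult.assoc)
  have eq: "RL_deriv (\<mu> - 1) f x = c * l - (c * l) * conv (power_kernel 1) ?g x" if x: "x > 0" for x
  \<comment> \<open>For \<mu> = 1 the operator is the identity by convention, and the Volterra
    equation already has the required form.\<close>
  proof (cases "\<mu> = 1")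
    case True
    then show ?thesis
      using x f'[OF x] by (simp add: RL_deriv_def)
  next
    case False
    then have s: "1 - \<mu> > 0" using mu by simp
    have "RL_deriv (\<mu> - 1) f x = conv (power_kernel (1 - \<mu>)) f x"
      using s by (simp add: RL_deriv_def RL_integral_eq_conv)
    also have "\<dots> = conv (power_kernel (1 - \<mu>)) (\<lambda>x. (c * l) * power_kernel \<mu> x + (- (c * l)) * conv (power_kernel \<mu>) ?g x) x"
      by (intro fun_cong[OF conv_cong] f' refl)
    also have "\<dots> = (c * l) * conv (power_kernel (1 - \<mu>)) (power_kernel \<mu>) x +
        (- (c * l)) * conv (power_kernel (1 - \<mu>)) (conv (power_kernel \<mu>) ?g) x"
      using mu s by (intro conv_linear_right[OF p p power_bounded_conv[OF p g]]) auto
    also have "\<dots> = c * l - (c * l) * conv (power_kernel 1) ?g x"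
      using mu s x by (simp add: conv_power_kernel conv_power_kernel_power_kernel[OF g])
    finally show ?thesis .
  qed
  have "(conv (power_kernel 1) ?g \<longlongrightarrow> 0) (at_right 0)"
    using mu by (intro power_bounded_tendsto_0[OF power_bounded_conv[OF p g]]) auto
  then have "((\<lambda>x. c * l - (c * l) * conv (power_kernel 1) ?g x) \<longlongrightarrow> c * l - (c * l) * 0) (at_right 0)"
    by (intro tendsto_intros)
  moreover have "\<forall>\<^sub>F x in at_right 0. c * l - (c * l) * conv (power_kernel 1) ?g x = RL_deriv (\<mu> - 1) f x"
    using eq by (simp add: eventually_at_right_less eventually_mono[OF eventually_at_right_less])
  ultimately show "(RL_deriv (\<mu> - 1) f \<longlongrightarrow> c * l) (at_right 0)"
    by (auto elim: Lim_transform_eventually)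
qed

lemma RL_integral_vanishes_at_0:
  assumes f: "power_bounded a f" and a: "a > 0" and s: "s < 0" "a - s > 1"
  shows "RL_defined s f" "(RL_deriv s f \<longlongrightarrow> 0) (at_right 0)"
proof -
  show "RL_defined s f"
    using RL_integrable_power_bounded[OF f a, of "- s"] s by (auto simp: RL_defined_def)
  have "RL_deriv s f = conv (power_kernel (- s)) f"
    using s by (auto simp: RL_deriv_def RL_integral_eq_conv fun_eq_iff)
  then show "(RL_deriv s f \<longlongrightarrow> 0) (at_right 0)"
    using a s by (auto intro!: power_bounded_tendsto_0[OF power_bounded_conv[OF power_bounded_power_kernel f]])
qed

section \<open>Iterated convolutions\<close>

text \<open>The singleton is a separate base case since convolution has no unit among functions; the
  empty list gets a dummy value.\<close>

fun conv_list :: "(real \<Rightarrow> real) list \<Rightarrow> real \<Rightarrow> real" where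
  "conv_list [] = (\<lambda>_. 0)"
| "conv_list [g] = g"
| "conv_list (g # h # gs) = conv g (conv_list (h # gs))"

lemma conv_list_Cons: "gs \<noteq> [] \<Longrightarrow> conv_list (g # gs) = conv g (conv_list gs)"
  by (cases gs) simp_all

lemma power_bounded_conv_list:
  assumes "gs \<noteq> []" "\<And>g. g \<in> set gs \<Longrightarrow> \<exists>a>0. power_bounded a g"
  shows "\<exists>a>0. power_bounded a (conv_list gs)"
  using assms
proof (induction gs rule: list_nonempty_induct)
  case (cons g gs)
  obtain a where "a > 0" "power_bounded a g" using cons.prems by auto
  moreover obtain b where "b > 0" "power_bounded b (conv_list gs)" using cons by auto
  ultimately have "a + b > 0" "power_bounded (a + b) (conv g (conv_list gs))"
    by (auto intro: power_bounded_conv)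
  then show ?case using cons.hyps by (auto simp: conv_list_Cons)
qed simp

lemma conv_list_nonpos:
  assumes "\<And>g. g \<in> set gs \<Longrightarrow> g x = 0" "x \<le> 0"
  shows "conv_list gs x = 0"
  using assms by (induction gs rule: conv_list.induct) simp_all

context
  fixes D :: "'i \<Rightarrow> (real \<Rightarrow> real) \<Rightarrow> bool" and L :: "'i \<Rightarrow> (real \<Rightarrow> real) \<Rightarrow> real \<Rightarrow> real"
    and g :: "'i \<Rightarrow> real \<Rightarrow> real" and k :: "'i \<Rightarrow> real"
begin

text \<open>The list order matches the order in which the operators act, so each one meets its own
  density at the head. A nonempty \<open>js\<close> keeps a genuine convolution factor at every
  stage.\<close>

lemma fold_inverts:
  assumes "\<And>i. i \<in> set is \<Longrightarrow> inverts (D i) (L i) (g i) (k i)"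
    and "\<And>i. i \<in> set (is @ js) \<Longrightarrow> \<exists>a>0. power_bounded a (g i)"
    and "\<And>x. x > 0 \<Longrightarrow> f x = c * conv_list (map g (is @ js)) x" "js \<noteq> []"
  shows "x > 0 \<Longrightarrow> fold L is f x = c * prod_list (map k is) * conv_list (map g js) x"
  using assms
proof (induction "is" arbitrary: f c x)
  case (Cons i "is")
  obtain b where b: "b > 0" "power_bounded b (conv_list (map g (is @ js)))"
    using power_bounded_conv_list[of "map g (is @ js)"] Cons.prems by auto
  have "\<forall>x>0. f x = c * conv (g i) (conv_list (map g (is @ js))) x"
    using Cons.prems by (simp add: conv_list_Cons)
  with b Cons.prems(2)[of i] have "L i f y = c * k i * conv_list (map g (is @ js)) y" if "y > 0" for y
    using that unfolding inverts_def by auto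
  from Cons.IH[OF Cons.prems(1) _ _ this] Cons.prems show ?case by (simp add: mult.assoc)
qed simp

lemma fold_inverts_last:
  assumes "\<And>i. i \<in> set is \<Longrightarrow> inverts (D i) (L i) (g i) (k i)"
    and "\<And>i. i \<in> set is \<Longrightarrow> \<exists>a>0. power_bounded a (g i)"
    and "\<And>x. x > 0 \<Longrightarrow> f x = c * conv_list (map g is) x" "is \<noteq> []" "x > 0"
  shows "fold L is f x = 0"
proof -
  obtain i ks where "is": "is = ks @ [i]" using assms(4) by (metis rev_exhaust)
  have "\<forall>x>0. fold L ks f x = (c * prod_list (map k ks)) * g i x"
    using fold_inverts[of ks "[i]" f c] assms "is" by auto
  moreover have "inverts (D i) (L i) (g i) (k i)" using assms(1) "is" by auto
  ultimately show ?thesis using assms(5) "is" unfolding inverts_def by auto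
qed

text \<open>Which clause of \<open>inverts\<close> applies depends on whether any density follows
  i.\<close>

lemma fold_inverts_defined:
  assumes inv: "\<And>l. l \<in> set (ks @ [i]) \<Longrightarrow> inverts (D l) (L l) (g l) (k l)"
    and g: "\<And>l. l \<in> set (ks @ i # js) \<Longrightarrow> \<exists>a>0. power_bounded a (g l)"
    and f: "\<And>x. x > 0 \<Longrightarrow> f x = c * conv_list (map g (ks @ i # js)) x"
  shows "D i (fold L ks f)"
proof -
  have *: "\<forall>x>0. fold L ks f x = (c * prod_list (map k ks)) * conv_list (map g (i # js)) x"
    using fold_inverts[of ks "i # js" f c] assms by auto
  have i: "inverts (D i) (L i) (g i) (k i)" using inv by auto
  show ?thesis
  proof (cases "js = []")
    case True
    then show ?thesis using * i unfolding inverts_def by auto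
  next
    case False
    obtain b where b: "b > 0" "power_bounded b (conv_list (map g js))"
      using power_bounded_conv_list[of "map g js"] False g by auto
    have "\<forall>x>0. fold L ks f x = (c * prod_list (map k ks)) * conv (g i) (conv_list (map g js)) x"
      using * False by (simp add: conv_list_Cons)
    then show ?thesis using i b unfolding inverts_def by blast
  qed
qed

end

section \<open>Densities of sums and uniqueness of the continuous version\<close>

lemma zero_ext_id: "(\<And>x. x \<le> 0 \<Longrightarrow> g x = 0) \<Longrightarrow> zero_ext g = g"
  by (auto simp: zero_ext_def fun_eq_iff split: split_indicator)

text \<open>The nonnegative convolution integral could be infinite at some points; the power bounds
  make it finite everywhere, so it equals the real-valued \<open>conv\<close>.\<close>

lemma (in prob_space) has_density_conv:
  assumes ind: "indep_var borel X borel Y"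
    and X: "has_density M X g" and Y: "has_density M Y h"
    and g: "power_bounded a g" "a > 0" "\<And>x. x \<le> 0 \<Longrightarrow> g x = 0"
    and h: "power_bounded b h" "b > 0" "\<And>x. x \<le> 0 \<Longrightarrow> h x = 0"
  shows "has_density M (\<lambda>\<omega>. X \<omega> + Y \<omega>) (conv g h)"
proof -
  have ext: "zero_ext g = g" "zero_ext h = h"
    using g(3) h(3) by (auto intro!: zero_ext_id)
  have nonneg: "g x \<ge> 0" "h x \<ge> 0" for x using X Y by (auto simp: has_density_def)
  have "distributed M lborel (\<lambda>\<omega>. X \<omega> + Y \<omega>)
      (\<lambda>x. \<integral>\<^sup>+y. ennreal (g (x - y)) * ennreal (h y) \<partial>lborel)"
    using X Y by (intro distributed_convolution[OF ind]) (auto simp: has_density_def)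
  also have "(\<lambda>x. \<integral>\<^sup>+y. ennreal (g (x - y)) * ennreal (h y) \<partial>lborel) = (\<lambda>x. ennreal (conv g h x))"
  proof
    fix x
    have "(\<integral>\<^sup>+y. ennreal (g (x - y)) * ennreal (h y) \<partial>lborel) = (\<integral>\<^sup>+y. ennreal (g (x - y) * h y) \<partial>lborel)"
      using nonneg by (simp add: ennreal_mult)
    also have "\<dots> = ennreal (conv g h x)"
      unfolding conv_def ext
      using conv_integrable[OF g(1) h(1) g(2) h(2), of x] nonneg
      by (intro nn_integral_eq_integral) (auto simp: ext)
    finally show "(\<integral>\<^sup>+y. ennreal (g (x - y)) * ennreal (h y) \<partial>lborel) = ennreal (conv g h x)" .
  qed
  finally show ?thesis
    using nonneg by (auto simp: has_density_def conv_def ext)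
qed

lemma (in prob_space) has_density_conv_list:
  assumes "is \<noteq> []" "distinct is" "indep_vars (\<lambda>_. borel) X (set is)"
    and "\<And>i. i \<in> set is \<Longrightarrow> has_density M (X i) (g i)"
    and "\<And>i. i \<in> set is \<Longrightarrow> \<exists>a>0. power_bounded a (g i)"
    and "\<And>i x. i \<in> set is \<Longrightarrow> x \<le> 0 \<Longrightarrow> g i x = 0"
  shows "has_density M (\<lambda>\<omega>. \<Sum>i\<in>set is. X i \<omega>) (conv_list (map g is))"
  using assms
proof (induction "is" rule: list_nonempty_induct)
  case (cons i "is")
  obtain a where a: "a > 0" "power_bounded a (g i)" using cons.prems(4)[of i] by auto
  obtain b where b: "b > 0" "power_bounded b (conv_list (map g is))"
    using power_bounded_conv_list[of "map g is"] cons.hyps cons.prems(4) by auto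
  have "indep_var borel (X i) borel (\<lambda>\<omega>. \<Sum>i\<in>set is. X i \<omega>)"
    using cons.prems by (intro indep_vars_sum) auto
  moreover have "indep_vars (\<lambda>_. borel) X (set is)"
    using cons.prems(2) by (rule indep_vars_subset) auto
  then have "has_density M (\<lambda>\<omega>. \<Sum>i\<in>set is. X i \<omega>) (conv_list (map g is))"
    using cons by auto
  ultimately have "has_density M (\<lambda>\<omega>. X i \<omega> + (\<Sum>i\<in>set is. X i \<omega>)) (conv (g i) (conv_list (map g is)))"
    using cons.prems by (intro has_density_conv[OF _ _ _ a(2,1) _ b(2,1)]) (auto intro!: conv_list_nonpos)
  then show ?case using cons by (simp add: conv_list_Cons)
qed simp

text \<open>The points of x > 0 where two versions differ form an open set. It is Lebesgue null,
  hence empty.\<close>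

lemma (in prob_space) continuous_density_unique:
  assumes f: "is_continuous_density M T f" and g: "is_continuous_density M T g" and x: "x > 0"
  shows "f x = g x"
proof (rule ccontr)
  assume neq: "f x \<noteq> g x"
  define U where "U = {0<..} \<inter> (\<lambda>x. f x - g x) -` (- {0})"
  have "continuous_on {0<..} (\<lambda>x. f x - g x)"
    using f g by (auto simp: is_continuous_density_def intro!: continuous_intros)
  then have "open U"
    unfolding U_def by (rule continuous_open_preimage) auto
  have "AE x in lborel. ennreal (f x) = ennreal (g x)"
    using f g by (intro distributed_unique[of lborel T]) (auto simp: is_continuous_density_def has_density_def)
  \<comment> \<open>Both densities are nonnegative everywhere, so equality in \<open>ennreal\<close>
    gives equality of the reals.\<close>
  then have "AE x in lborel. x \<notin> U"
    using f g by (auto simp: U_def is_continuous_density_def has_density_def elim!: AE_mp)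
  then have "U \<in> null_sets lborel"
    using \<open>open U\<close> by (subst AE_iff_null_sets) auto
  then have "negligible U"
    by (simp add: negligible_iff_null_sets null_sets_completionI)
  moreover have "x \<in> U" using neq x by (simp add: U_def)
  ultimately show False using open_not_negligible[OF \<open>open U\<close>] by auto
qed

section \<open>From indexed operator compositions to folds over lists\<close>

lemma prod_list_map_upt: "prod_list (map f [a..<Suc b]) = (\<Prod>i=a..b. f i)"
  by (subst prod.distinct_set_conv_list[symmetric]) (simp_all add: atLeastLessThanSuc_atLeastAtMost del: upt_Suc)

lemma compose_ops_eq_fold_map:
  assumes "\<And>i. L' (\<iota> i) = L i"
  shows "compose_ops a b L f = fold L' (map \<iota> [a..<Suc b]) f"
  by (simp add: compose_ops_def fold_map o_def assms del: upt_Suc)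

text \<open>\<open>\<iota>\<close> embeds the indices into a common index type. The operators in
  \<open>ls\<close> have already acted, and the densities in \<open>js\<close> remain after the
  whole composition.\<close>

lemma compose_defined_if_inverts:
  assumes L: "\<And>i. L' (\<iota> i) = L i" and D: "\<And>i. D' (\<iota> i) = D i"
    and inv: "\<And>i. i \<in> set (ls @ map \<iota> [a..<Suc b]) \<Longrightarrow> inverts (D' i) (L' i) (g i) (k i)"
    and g: "\<And>i. i \<in> set (ls @ map \<iota> [a..<Suc b] @ js) \<Longrightarrow> \<exists>a>0. power_bounded a (g i)"
    and f: "\<And>x. x > 0 \<Longrightarrow> f x = c * conv_list (map g (ls @ map \<iota> [a..<Suc b] @ js)) x"
  shows "compose_defined a b D L (fold L' ls f)"
  unfolding compose_defined_def
proof
  fix j assume j: "j \<in> {a..b}"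
  then have upt: "[a..<Suc b] = [a..<j] @ j # [Suc j..<Suc b]"
    using upt_add_eq_append[of a j "Suc b - j"] upt_conv_Cons[of j "Suc b"] by (simp del: upt_Suc)
  have eq: "ls @ map \<iota> [a..<Suc b] @ js = (ls @ map \<iota> [a..<j]) @ \<iota> j # map \<iota> [Suc j..<Suc b] @ js"
    by (simp only: upt map_append list.map append_assoc append_Cons)
  have inv': "inverts (D' i) (L' i) (g i) (k i)" if "i \<in> set ((ls @ map \<iota> [a..<j]) @ [\<iota> j])" for i
    using that j by (intro inv) (auto simp del: upt_Suc)
  have "D' (\<iota> j) (fold L' (ls @ map \<iota> [a..<j]) f)"
    by (rule fold_inverts_defined[where D = D' and L = L' and g = g and k = k and c = c, OF inv'])
      (use g f in \<open>simp_all only: eq\<close>)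
  then show "D j (fold L [a..<j] (fold L' ls f))"
    by (simp add: D fold_map o_def L)
qed

theorem theorem1:
  fixes M :: "'a measure"
    and m n :: nat
    and r lam1 lam2 \<mu> :: "nat \<Rightarrow> real"
    and Y Z :: "nat \<Rightarrow> 'a \<Rightarrow> real"
    and T :: "'a \<Rightarrow> real"
  assumes "prob_space M"
    and "m \<noteq> 0 \<or> n \<noteq> 0"
    and "\<And>i. i \<in> {1..m} \<Longrightarrow> r i > 0"
    and "\<And>i. i \<in> {1..m} \<Longrightarrow> lam1 i > 0"
    and "\<And>j. j \<in> {1..n} \<Longrightarrow> lam2 j > 0"
    and "\<And>j. j \<in> {1..n} \<Longrightarrow> 0 < \<mu> j \<and> \<mu> j \<le> 1"
    and "\<And>i. i \<in> {1..m} \<Longrightarrow>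
           has_density M (Y i) (gamma_density (r i) (lam1 i))"
    and "\<And>j. j \<in> {1..n} \<Longrightarrow>
           has_density M (Z j) (mittag_leffler_density (\<mu> j) (lam2 j))"
    and "prob_space.indep_vars M (\<lambda>_. borel) (case_sum Y Z) ({1..m} <+> {1..n})"
    and "\<And>\<omega>. T \<omega> = (\<Sum>i=1..m. Y i \<omega>) + (\<Sum>j=1..n. Z j \<omega>)"
  shows "(\<exists>f. is_continuous_density M T f) \<and>
    (\<forall>f. is_continuous_density M T f \<longrightarrow>
      gamma_ops_defined m r lam1 f \<and>
      RL_ops_defined 1 n \<mu> lam2 (gamma_ops m r lam1 f) \<and>
      (\<forall>t>0. RL_ops 1 n \<mu> lam2 (gamma_ops m r lam1 f) t = 0) \<and>
      (n \<noteq> 0 \<longrightarrow>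
        RL_ops_defined 2 n \<mu> lam2 (gamma_ops m r lam1 f) \<and>
        RL_defined (\<mu> 1 - 1) (RL_ops 2 n \<mu> lam2 (gamma_ops m r lam1 f)) \<and>
        ((RL_deriv (\<mu> 1 - 1) (RL_ops 2 n \<mu> lam2 (gamma_ops m r lam1 f)))
           \<longlongrightarrow> (\<Prod>i=1..m. lam1 i powr r i) * (\<Prod>j=1..n. lam2 j)) (at_right 0) \<and>
        (\<forall>k\<in>{2..nat \<lceil>(\<Sum>j=1..n. \<mu> j) + (\<Sum>i=1..m. r i)\<rceil>}.
          RL_defined (\<mu> 1 - real k) (RL_ops 2 n \<mu> lam2 (gamma_ops m r lam1 f)) \<and>
          ((RL_deriv (\<mu> 1 - real k) (RL_ops 2 n \<mu> lam2 (gamma_ops m r lam1 f)))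
             \<longlongrightarrow> 0) (at_right 0))))"
proof -
  interpret prob_space M by fact
  define X where "X = case_sum Y Z"
  define g where "g = case_sum (\<lambda>i. gamma_density (r i) (lam1 i)) (\<lambda>j. mittag_leffler_density (\<mu> j) (lam2 j))"
  define D where "D = case_sum (\<lambda>i. R_defined (lam1 i) (r i)) (\<lambda>j. RL_defined (\<mu> j))"
  define L where "L = case_sum (\<lambda>i. R_op (lam1 i) (r i)) (\<lambda>j. RL_deriv_plus (\<mu> j) (lam2 j))"
  define \<kappa> where "\<kappa> = case_sum (\<lambda>i. lam1 i powr r i) lam2"
  \<comment> \<open>The disjoint sum treats gamma and Mittag-Leffler summands as one indexed
    family.\<close>
  define I where "I = {1..m} <+> {1..n}"
  define G where "G = map (Inl :: nat \<Rightarrow> nat + nat) [1..<Suc m]"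
  define H where "H a = map (Inr :: nat \<Rightarrow> nat + nat) [a..<Suc n]" for a
  have L_simps: "L (Inl i) = R_op (lam1 i) (r i)" "L (Inr i) = RL_deriv_plus (\<mu> i) (lam2 i)" for i
    by (simp_all add: L_def)
  have D_simps: "D (Inl i) = R_defined (lam1 i) (r i)" "D (Inr i) = RL_defined (\<mu> i)" for i
    by (simp_all add: D_def)
  have inv: "inverts (D i) (L i) (g i) (\<kappa> i)" if "i \<in> I" for i
    using that assms(3,6) by (auto simp: I_def D_def L_def g_def \<kappa>_def
        intro!: inverts_gamma_density inverts_mittag_leffler_density)
  have g: "\<exists>a>0. power_bounded a (g i)" if "i \<in> I" for i
  proof (cases i)
    case (Inl j)
    then have "r j > 0" using that assms(3) by (auto simp: I_def)
    then show ?thesis using Inl power_bounded_gamma_density by (auto simp: g_def)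
  next
    case (Inr j)
    then have "\<mu> j > 0" using that assms(6) by (auto simp: I_def)
    then show ?thesis using Inr power_bounded_mittag_leffler_density by (auto simp: g_def)
  qed
  have g_nonpos: "g i x = 0" if "x \<le> 0" for i x
    using that by (auto simp: g_def gamma_density_def mittag_leffler_density_def split: sum.split)
  have dens: "has_density M (X i) (g i)" if "i \<in> I" for i
    using that assms(7,8) by (auto simp: I_def X_def g_def)
  have T: "T = (\<lambda>\<omega>. \<Sum>i\<in>I. X i \<omega>)"
    unfolding I_def X_def using assms(10) by (auto simp: sum.Plus)
  have set_G: "set G = Inl ` {1..m}" and set_H: "set (H a) = Inr ` {a..n}" for a
    by (auto simp: G_def H_def simp del: upt_Suc)
  have set1: "set (G @ H 1) = I"
    by (auto simp: set_G set_H I_def Plus_def)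
  have I_nonempty: "I \<noteq> {}" using assms(2) by (auto simp: I_def)
  \<comment> \<open>Every ordering of the summands gives a continuous density of the same variable.
    By uniqueness all orderings agree on x > 0, so the factors may be arranged as the operators
    require.\<close>
  have cont_dens: "is_continuous_density M T (conv_list (map g ks))" if "set ks = I" "distinct ks" for ks
  proof -
    have "ks \<noteq> []" using that(1) I_nonempty by auto
    then have "has_density M T (conv_list (map g ks))"
      using has_density_conv_list[of ks X g] that assms(9)[folded X_def I_def] dens g g_nonpos
      by (simp add: T)
    moreover have "\<exists>a>0. power_bounded a (conv_list (map g ks))"
      using that g \<open>ks \<noteq> []\<close> by (intro power_bounded_conv_list) auto
    ultimately show ?thesis
      by (auto simp: is_continuous_density_def power_bounded_continuous)
  qed
  have dens1: "is_continuous_density M T (conv_list (map g (G @ H 1)))"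
    by (rule cont_dens[OF set1]) (auto simp: G_def H_def distinct_map simp del: upt_Suc)
  show ?thesis
  proof (intro conjI allI impI)
    show "\<exists>f. is_continuous_density M T f" using dens1 by blast
  next
    fix f assume f: "is_continuous_density M T f"
    have f1: "f x = 1 * conv_list (map g (G @ H 1)) x" if "x > 0" for x
      using continuous_density_unique[OF f dens1 that] by simp
    have gamma: "gamma_ops m r lam1 f = fold L G f"
      unfolding gamma_ops_def G_def by (rule compose_ops_eq_fold_map) (rule L_simps)
    have RL: "RL_ops a n \<mu> lam2 h = fold L (H a) h" for a h
      unfolding RL_ops_def H_def by (rule compose_ops_eq_fold_map) (rule L_simps)
    show "gamma_ops_defined m r lam1 f"
      unfolding gamma_ops_defined_def
    proof (rule compose_defined_if_inverts[where L' = L and D' = D and \<iota> = Inl and a = 1 and b = m and ls = "[]" and js = "H 1"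
          and g = g and k = \<kappa> and c = 1, OF L_simps(1) D_simps(1), folded G_def, unfolded fold_simps append_Nil])
    qed (use set1 inv g f1 in auto)
    show "RL_ops_defined 1 n \<mu> lam2 (gamma_ops m r lam1 f)"
      unfolding RL_ops_defined_def gamma
    proof (rule compose_defined_if_inverts[where L' = L and D' = D and \<iota> = Inr and a = 1 and b = n and js = "[]"
          and g = g and k = \<kappa> and c = 1, OF L_simps(2) D_simps(2), folded H_def])
    qed (use set1 inv g f1 in auto)
    show "RL_ops 1 n \<mu> lam2 (gamma_ops m r lam1 f) t = 0" if "t > 0" for t
    proof -
      have "fold L (G @ H 1) f t = 0"
        using inv g f1 set1 I_nonempty that
        by (intro fold_inverts_last[where D = D and g = g and k = \<kappa> and c = 1]) auto
      then show ?thesis by (simp add: RL gamma)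
    qed
  next
    fix f assume f: "is_continuous_density M T f" and n: "n \<noteq> 0"
    \<comment> \<open>The Mittag-Leffler density of index 1 is placed last, so that it alone
      survives the gamma operators and the factors from index 2 on.\<close>
    have set2: "set (G @ H 2 @ [Inr 1]) = I"
      using n by (auto simp: set_G set_H I_def Plus_def image_iff)
    have dens2: "is_continuous_density M T (conv_list (map g (G @ H 2 @ [Inr 1])))"
      by (rule cont_dens[OF set2]) (auto simp: G_def H_def distinct_map simp del: upt_Suc)
    have f2: "f x = 1 * conv_list (map g ((G @ H 2) @ [Inr 1])) x" if "x > 0" for x
      using continuous_density_unique[OF f dens2 that] by simp
    have gamma: "gamma_ops m r lam1 f = fold L G f"
      unfolding gamma_ops_def G_def by (rule compose_ops_eq_fold_map) (rule L_simps)
    have RL: "RL_ops a n \<mu> lam2 h = fold L (H a) h" for a h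
      unfolding RL_ops_def H_def by (rule compose_ops_eq_fold_map) (rule L_simps)
    show "RL_ops_defined 2 n \<mu> lam2 (gamma_ops m r lam1 f)"
      unfolding RL_ops_defined_def gamma
    proof (rule compose_defined_if_inverts[where L' = L and D' = D and \<iota> = Inr and a = 2 and b = n and js = "[Inr 1]"
          and g = g and k = \<kappa> and c = 1, OF L_simps(2) D_simps(2), folded H_def])
    qed (use set2 inv g f2 in auto)
    define c where "c = prod_list (map \<kappa> (G @ H 2))"
    define F where "F = RL_ops 2 n \<mu> lam2 (gamma_ops m r lam1 f)"
    have F: "F x = c * mittag_leffler_density (\<mu> 1) (lam2 1) x" if "x > 0" for x
    proof -
      have "fold L (G @ H 2) f x = 1 * prod_list (map \<kappa> (G @ H 2)) * conv_list (map g [Inr 1]) x"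
        by (rule fold_inverts[where D = D]) (use inv g f2 set2 that in auto)
      then show ?thesis by (simp add: F_def RL gamma c_def g_def)
    qed
    \<comment> \<open>\<open>c\<close> collects all constants except \<open>lam2 1\<close>, which
      the limit at 0 contributes.\<close>
    have "(\<Prod>j=1..n. lam2 j) = lam2 1 * (\<Prod>j=2..n. lam2 j)"
      using n by (subst prod.atLeast_Suc_atMost) (auto simp: numeral_2_eq_2)
    then have c: "c * lam2 1 = (\<Prod>i=1..m. lam1 i powr r i) * (\<Prod>j=1..n. lam2 j)"
      unfolding c_def G_def H_def
      by (simp add: \<kappa>_def o_def prod_list_map_upt mult_ac del: upt_Suc)
    have mu: "0 < \<mu> 1" "\<mu> 1 \<le> 1" using assms(6)[of 1] n by auto
    note at_0 = RL_deriv_mittag_leffler_density_at_0[OF mu F]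
    show "RL_defined (\<mu> 1 - 1) (RL_ops 2 n \<mu> lam2 (gamma_ops m r lam1 f))"
      using at_0(1) by (simp add: F_def)
    show "((RL_deriv (\<mu> 1 - 1) (RL_ops 2 n \<mu> lam2 (gamma_ops m r lam1 f)))
           \<longlongrightarrow> (\<Prod>i=1..m. lam1 i powr r i) * (\<Prod>j=1..n. lam2 j)) (at_right 0)"
      using at_0(2) unfolding F_def c .
    have Fpb: "power_bounded (\<mu> 1) F"
      by (rule power_bounded_cong[OF power_bounded_cmult[OF power_bounded_mittag_leffler_density[OF mu(1)]] F])
    show "\<forall>k\<in>{2..nat \<lceil>(\<Sum>j=1..n. \<mu> j) + (\<Sum>i=1..m. r i)\<rceil>}.
          RL_defined (\<mu> 1 - real k) (RL_ops 2 n \<mu> lam2 (gamma_ops m r lam1 f)) \<and>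
          ((RL_deriv (\<mu> 1 - real k) (RL_ops 2 n \<mu> lam2 (gamma_ops m r lam1 f)))
             \<longlongrightarrow> 0) (at_right 0)"
      \<comment> \<open>For order \<open>\<mu> 1 - real k\<close> with k \<ge> 2 the integral is
        negative in order, and the resulting power order is \<mu> 1 - (\<mu> 1 - k) = k > 1.\<close>
      using RL_integral_vanishes_at_0[OF Fpb mu(1)] mu by (auto simp: F_def[symmetric])
  qed
qed

end
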